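(* Let $n\ge1$, $N=2n$, and let $\alpha, \beta\in \mathbb{R}$. Then for all complex-valued functions $f\in C_{0}^{\infty}(\mathbb{H}_{n}\backslash\{\widetilde{x}'=0\})$ on the Heisenberg group $\mathbb{H}_n$ we have $$\|\mathcal{L} f\|^{2}_{L^{2}(\mathbb{H}_{n})}\geq ((N-4)\alpha-2\beta)\left\|\frac{\nabla_{H} f}{|\widetilde{x}'|}\right\|^{2}_{L^{2}(\mathbb{H}_{n})}-\alpha(\alpha-4)\left\|\frac{\widetilde{x}'\cdot\nabla_{H} f}{|\widetilde{x}'|^{2}}\right\|^{2}_{L^{2}(\mathbb{H}_{n})}+\beta((N-4)(\alpha-2)-\beta)\left\|\frac{f}{|\widetilde{x}'|^{2}}\right\|^{2}_{L^{2}(\mathbb{H}_{n})}$$ $$-2\alpha\int_{\mathbb{H}_{n}} \frac{\overline{f(\widetilde{x}',t)}\, Z Tf(\widetilde{x}',t)}{|\widetilde{x}'|^{2}}d\widetilde{x}' dt+ \alpha \|Tf\|^2_{L^{2}(\mathbb{H}_{n})}$$ and $$\|\mathcal{L} f\|^{2}_{L^{2}(\mathbb{H}_{n})}\geq (N\alpha-2\beta)\left\|\frac{\nabla_{H} f}{|\widetilde{x}'|}\right\|^{2}_{L^{2}(\mathbb{H}_{n})}-\alpha(\alpha+4)\left\|\frac{\widetilde{x}'\cdot\nabla_{H} f}{|\widetilde{x}'|^{2}}\right\|^{2}_{L^{2}(\mathbb{H}_{n})}$$ $$+\big(2(N-4)(\alpha(N-2)-\beta)-2\alpha^{2}(N-2)+\alpha\beta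 N-\beta^{2}\big)\left\|\frac{f}{|\widetilde{x}'|^{2}}\right\|^{2}_{L^{2}(\mathbb{H}_{n})}+ 2\alpha\int_{\mathbb{H}_{n}} \frac{\overline{f(\widetilde{x}',t)}\, Z Tf(\widetilde{x}',t)}{|\widetilde{x}'|^{2}}d\widetilde{x}' dt- \alpha \|Tf\|^2_{L^{2}(\mathbb{H}_{n})}.$$ Moreover, if $\alpha(\alpha-4)\geq0$, then $$\|\mathcal{L} f\|^{2}_{L^{2}(\mathbb{H}_{n})}\geq ((N-\alpha)\alpha-2\beta)\left\|\frac{\nabla_{H} f}{|\widetilde{x}'|}\right\|^{2}_{L^{2}(\mathbb{H}_{n})}+\beta((N-4)(\alpha-2)-\beta)\left\|\frac{f}{|\widetilde{x}'|^{2}}\right\|^{2}_{L^{2}(\mathbb{H}_{n})}$$ $$- 2\alpha\int_{\mathbb{H}_{n}} \frac{\overline{f(\widetilde{x}',t)}\, Z Tf(\widetilde{x}',t)}{|\widetilde{x}'|^{2}}d\widetilde{x}' dt+ \alpha \|Tf\|^2_{L^{2}(\mathbb{H}_{n})},$$ and if $\alpha(\alpha+4)\geq0$, then $$\|\mathcal{L} f\|^{2}_{L^{2}(\mathbb{H}_{n})}\geq (-2\beta+\alpha(N-\alpha)-4\alpha)\left\|\frac{\nabla_{H} f}{|\widetilde{x}'|}\right\|^{2}_{L^{2}(\mathbb{H}_{n})}$$ $$+\big(2(N-4)(\alpha(N-2)-\beta)-2\alpha^{2}(N-2)+\alpha\beta N-\beta^{2}\big)\left\|\frac{f}{|\widetilde{x}'|^{2}}\right\|^{2}_{L^{2}(\mathbb{H}_{n})}+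 2\alpha\int_{\mathbb{H}_{n}} \frac{\overline{f(\widetilde{x}',t)}\, Z Tf(\widetilde{x}',t)}{|\widetilde{x}'|^{2}}d\widetilde{x}' dt- \alpha \|Tf\|^2_{L^{2}(\mathbb{H}_{n})}.$$
   Context: The Heisenberg group $\mathbb{H}_n$ is $\mathbb{R}^{2n+1}=\mathbb{R}^n\times\mathbb{R}^n\times\mathbb{R}$ with points $(x,y,t)$ and group law $(x^{(1)},y^{(1)},t^{(1)})(x^{(2)},y^{(2)},t^{(2)})=(x^{(1)}+x^{(2)},y^{(1)}+y^{(2)},t^{(1)}+t^{(2)}+\frac12(x^{(1)}y^{(2)}-x^{(2)}y^{(1)}))$, where $x^{(1)}y^{(2)}$, $x^{(2)}y^{(1)}$ are scalar products in $\mathbb{R}^n$. Left-invariant vector fields: $X_j=\partial_{x_j}-\frac{y_j}{2}\partial_t$, $Y_j=\partial_{y_j}+\frac{x_j}{2}\partial_t$ ($j=1,\ldots,n$), $T=\partial_t$. Notation: $N=2n$; $\widetilde{x}'=(x_1,\ldots,x_n,y_1,\ldots,y_n)\in\mathbb{R}^N$; $|\widetilde{x}'|=\sqrt{\sum_{j=1}^n(x_j^2+y_j^2)}$; $\nabla_H=(X_1,\ldots,X_n,Y_1,\ldots,Y_n)$; $|\nabla_Hf|^2=\sum_{j=1}^n(|X_jf|^2+|Y_jf|^2)$; $\widetilde{x}'\cdot\nabla_Hf=\sum_{j=1}^n(x_jX_jf+y_jY_jf)$; $\mathcal{L}=\sum_{j=1}^n(X_j^2+Y_j^2)$ is the sub-Laplacian;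 $Z=\sum_{j=1}^n(x_j\partial_{y_j}-y_j\partial_{x_j})$ is the tangential derivative. The measure is Lebesgue measure $d\widetilde{x}'dt$ on $\mathbb{R}^{2n+1}$. $C_0^\infty(\mathbb{H}_n\backslash\{\widetilde{x}'=0\})$ denotes smooth functions compactly supported in $\{\widetilde{x}'\neq0\}$. The integral $\int_{\mathbb{H}_n}\overline{f}\,ZTf\,|\widetilde{x}'|^{-2}d\widetilde{x}'dt$ is real-valued for every such complex-valued $f$, so the inequalities make sense. *)

theory Defs
  imports "HOL-Analysis.Analysis"
begin

text \<open>A point of the Heisenberg group \<open>H_n\<close>, \<open>n = CARD('n)\<close>, is \<open>(x, y, t)\<close>.\<close>

type_synonym 'n heis = "(real ^ 'n) \<times> (real ^ 'n) \<times> real"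

definition heis_mult :: "'n::finite heis \<Rightarrow> 'n heis \<Rightarrow> 'n heis" where
  "heis_mult p q =
     (fst p + fst q, fst (snd p) + fst (snd q),
      snd (snd p) + snd (snd q)
        + 1/2 * (fst p \<bullet> fst (snd q) - fst q \<bullet> fst (snd p)))"

definition horiz :: "'n::finite heis \<Rightarrow> (real ^ 'n) \<times> (real ^ 'n)" where
  "horiz p = (fst p, fst (snd p))"

lemma norm_horiz:
  "norm (horiz p) = sqrt (\<Sum>j\<in>UNIV. (fst p $ j)\<^sup>2 + (fst (snd p) $ j)\<^sup>2)"
  by (simp add: horiz_def norm_Pair norm_vec_def L2_set_def sum_nonneg sum.distrib)

subsection \<open>Smooth functions with compact support\<close>

text \<open>Continuity is demanded only of the derivatives of top order, the lower ones being
  differentiable. Letting \<open>v\<close> range over all directions rather than a basis makes no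
  difference, by linearity of the derivative.\<close>

primrec C_k :: "nat \<Rightarrow> ('a::real_normed_vector \<Rightarrow> 'b::real_normed_vector) \<Rightarrow> bool" where
  "C_k 0 f \<longleftrightarrow> continuous_on UNIV f"
| "C_k (Suc k) f \<longleftrightarrow>
     (\<forall>p. f differentiable (at p)) \<and> (\<forall>v. C_k k (\<lambda>p. frechet_derivative f (at p) v))"

definition smooth :: "('a::real_normed_vector \<Rightarrow> 'b::real_normed_vector) \<Rightarrow> bool" where
  "smooth f \<longleftrightarrow> (\<forall>k. C_k k f)"

text \<open>Members of \<open>C_0^\<infinity>(\<Omega>)\<close> are taken to be defined on the whole space,
  being extended by zero outside \<open>\<Omega>\<close>.\<close>

definition test_functions :: "'a::real_normed_vector set \<Rightarrow> ('a \<Rightarrow> complex) set" where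
  "test_functions \<Omega> = {f. smooth f \<and> compact (closure {p. f p \<noteq> 0}) \<and> closure {p. f p \<noteq> 0} \<subseteq> \<Omega>}"

subsection \<open>Differential operators\<close>

definition d_x :: "'n::finite \<Rightarrow> ('n heis \<Rightarrow> complex) \<Rightarrow> 'n heis \<Rightarrow> complex" where
  "d_x j f p = frechet_derivative f (at p) (axis j 1, 0, 0)"

definition d_y :: "'n::finite \<Rightarrow> ('n heis \<Rightarrow> complex) \<Rightarrow> 'n heis \<Rightarrow> complex" where
  "d_y j f p = frechet_derivative f (at p) (0, axis j 1, 0)"

definition vf_T :: "('n::finite heis \<Rightarrow> complex) \<Rightarrow> 'n heis \<Rightarrow> complex" where
  "vf_T f p = frechet_derivative f (at p) (0, 0, 1)"

definition vf_X :: "'n::finite \<Rightarrow> ('n heis \<Rightarrow> complex) \<Rightarrow> 'n heis \<Rightarrow> complex" where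
  "vf_X j f p = d_x j f p - of_real (fst (snd p) $ j / 2) * vf_T f p"

definition vf_Y :: "'n::finite \<Rightarrow> ('n heis \<Rightarrow> complex) \<Rightarrow> 'n heis \<Rightarrow> complex" where
  "vf_Y j f p = d_y j f p + of_real (fst p $ j / 2) * vf_T f p"

definition vf_Z :: "('n::finite heis \<Rightarrow> complex) \<Rightarrow> 'n heis \<Rightarrow> complex" where
  "vf_Z f p = (\<Sum>j\<in>UNIV. of_real (fst p $ j) * d_y j f p - of_real (fst (snd p) $ j) * d_x j f p)"

definition sub_laplacian :: "('n::finite heis \<Rightarrow> complex) \<Rightarrow> 'n heis \<Rightarrow> complex" where
  "sub_laplacian f p = (\<Sum>j\<in>UNIV. vf_X j (vf_X j f) p + vf_Y j (vf_Y j f) p)"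

definition hgrad :: "('n::finite heis \<Rightarrow> complex) \<Rightarrow> 'n heis \<Rightarrow> (complex ^ 'n) \<times> (complex ^ 'n)" where
  "hgrad f p = ((\<chi> j. vf_X j f p), (\<chi> j. vf_Y j f p))"

lemma norm_hgrad_squared:
  "(norm (hgrad f p))\<^sup>2 = (\<Sum>j\<in>UNIV. (norm (vf_X j f p))\<^sup>2 + (norm (vf_Y j f p))\<^sup>2)"
  by (simp add: hgrad_def norm_Pair norm_vec_def L2_set_def sum_nonneg sum.distrib)

definition horiz_dot_hgrad :: "('n::finite heis \<Rightarrow> complex) \<Rightarrow> 'n heis \<Rightarrow> complex" where
  "horiz_dot_hgrad f p =
     (\<Sum>j\<in>UNIV. of_real (fst p $ j) * vf_X j f p + of_real (fst (snd p) $ j) * vf_Y j f p)"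

lemma vf_left_invariant:
  fixes f :: "'n::finite heis \<Rightarrow> complex"
  assumes f: "f differentiable (at (heis_mult a p))"
  shows "vf_X j (\<lambda>q. f (heis_mult a q)) p = vf_X j f (heis_mult a p)"
    and "vf_Y j (\<lambda>q. f (heis_mult a q)) p = vf_Y j f (heis_mult a p)"
    and "vf_T (\<lambda>q. f (heis_mult a q)) p = vf_T f (heis_mult a p)"
proof -
  let ?D = "frechet_derivative f (at (heis_mult a p))"
  let ?L = "\<lambda>v::'n heis. (fst v, fst (snd v), snd (snd v)
               + 1/2 * (fst a \<bullet> fst (snd v) - fst v \<bullet> fst (snd a)))"
  have L: "(heis_mult a has_derivative ?L) (at p)"
    unfolding heis_mult_def by (auto intro!: derivative_eq_intros)
  have Df: "(f has_derivative ?D) (at (heis_mult a p))"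
    using f frechet_derivative_works by blast
  then interpret D: linear ?D by (rule has_derivative_linear)
  have "((\<lambda>q. f (heis_mult a q)) has_derivative (\<lambda>v. ?D (?L v))) (at p)"
    by (rule has_derivative_compose[OF L Df])
  then have eq: "frechet_derivative (\<lambda>q. f (heis_mult a q)) (at p) = (\<lambda>v. ?D (?L v))"
    by (rule frechet_derivative_at[symmetric])
  have T: "?D (0, 0, s) = of_real s * ?D (0, 0, 1)" for s
    using D.scale[of s "(0, 0, 1)"] by (simp add: scaleR_conv_of_real)
  have X: "?D (u, 0, s) = ?D (u, 0, 0) + of_real s * ?D (0, 0, 1)" for u s
    using D.add[of "(u, 0, 0)" "(0, 0, s)"] T[of s] by simp
  have Y: "?D (0, u, s) = ?D (0, u, 0) + of_real s * ?D (0, 0, 1)" for u s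
    using D.add[of "(0, u, 0)" "(0, 0, s)"] T[of s] by simp
  show "vf_T (\<lambda>q. f (heis_mult a q)) p = vf_T f (heis_mult a p)"
    by (simp add: vf_T_def eq)
  have coords: "fst (heis_mult a p) = fst a + fst p"
    "fst (snd (heis_mult a p)) = fst (snd a) + fst (snd p)"
    by (simp_all add: heis_mult_def)
  show "vf_X j (\<lambda>q. f (heis_mult a q)) p = vf_X j f (heis_mult a p)"
    unfolding vf_X_def d_x_def vf_T_def eq coords
    using X[of "axis j 1" "- (fst (snd a) $ j / 2)"]
    by (simp add: inner_axis inner_axis' algebra_simps add_divide_distrib)
  show "vf_Y j (\<lambda>q. f (heis_mult a q)) p = vf_Y j f (heis_mult a p)"
    unfolding vf_Y_def d_y_def vf_T_def eq coords
    using Y[of "axis j 1" "fst a $ j / 2"]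
    by (simp add: inner_axis inner_axis' algebra_simps add_divide_distrib)
qed

subsection \<open>Integral quantities\<close>

definition L2_norm :: "('a::euclidean_space \<Rightarrow> 'b::real_normed_vector) \<Rightarrow> real" where
  "L2_norm g = sqrt (LINT p|lborel. (norm (g p))\<^sup>2)"

text \<open>The integral below is complex by type, but real-valued on test functions:
  \<open>Z\<close> and \<open>T\<close> are commuting, formally skew-adjoint, and annihilate \<open>norm (horiz p)\<close>. Hence
  taking its real part in a real inequality discards nothing.\<close>

definition ZT_integral :: "('n::finite heis \<Rightarrow> complex) \<Rightarrow> complex" where
  "ZT_integral f =
     (LINT p|lborel. cnj (f p) * vf_Z (vf_T f) p / of_real ((norm (horiz p))\<^sup>2))"

end

theory Submission
  imports Defs
begin

text \<open>
  Write \<open>x\<close> for the horizontal point, \<open>L\<close> for the sub-Laplacian, \<open>E = x . grad_H\<close>, which is the Euler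
  operator of the horizontal variables, and \<open>A\<close>, \<open>B\<close>, \<open>C\<close> for the squared norms of
  \<open>grad_H f / |x|\<close>, \<open>E f / |x|^2\<close>, \<open>f / |x|^2\<close>. For real \<open>a\<close>, \<open>b\<close> the squared norm of
  \<open>L f + a E f / |x|^2 + b f / |x|^2\<close> is nonnegative. Expanding it leaves three cross terms, which are
  evaluated by parts:
  \<^item> the pairing of \<open>E f / |x|^2\<close> with \<open>f / |x|^2\<close> has real part \<open>- (N - 4) C / 2\<close>, because the
    divergence of \<open>E\<close> is \<open>N\<close> and \<open>|x|^(-4)\<close> has degree \<open>-4\<close> (\<open>Re_L2_inner_euler_weight_pow\<close>);
  \<^item> the pairing of \<open>L f\<close> with \<open>f / |x|^2\<close> has real part \<open>- A - (N - 4) C\<close>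
    (\<open>Re_L2_inner_sub_laplacian_weighted\<close>);
  \<^item> the pairing of \<open>L f\<close> with \<open>E f / |x|^2\<close> has real part \<open>2 B + (N - 4) A / 2 - Q + D / 2\<close>, with \<open>Q\<close>
    the integral of \<open>cnj f * Z T f / |x|^2\<close> and \<open>D\<close> the squared norm of \<open>T f\<close>
    (\<open>Re_L2_inner_sub_laplacian_euler\<close>).

  The last identity is the one where the group structure enters. The commutator of a horizontal field
  with \<open>E\<close> is not the field alone but contains a multiple of \<open>T\<close> (\<open>hfield_euler\<close>);
  summing these multiples against the gradient produces \<open>Z T\<close> and \<open>T\<close>.

  The choice \<open>(a, b) = (- \<alpha>, - \<beta>)\<close> gives the first inequality and \<open>(a, b) = (\<alpha>, \<alpha> (N - 2) - \<beta>)\<close> the second.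
  The other two follow from \<open>B \<le> A\<close>, which is the Cauchy-Schwarz inequality (\<open>euler_le_hgrad\<close>).

  The analysis rests on two facts about smooth compactly supported functions: directional
  derivatives have integral zero (\<open>integral_dir_deriv_eq_zero\<close>), and they commute
  (\<open>dir_deriv_commute\<close>). Division by \<open>|x|^2\<close> preserves smooth functions supported away from
  \<open>x = 0\<close> (\<open>test_functions_divide\<close>), so every function that occurs is again such a test function, and every
  integral converges.
\<close>

section \<open>Directional derivatives and their symmetry\<close>

definition dir_deriv :: "'a::real_normed_vector \<Rightarrow> ('a \<Rightarrow> 'b::real_normed_vector) \<Rightarrow> 'a \<Rightarrow> 'b" where
  "dir_deriv v f p = frechet_derivative f (at p) v"

lemma dir_deriv_eqI: "(f has_derivative f') (at p) \<Longrightarrow> dir_deriv v f p = f' v"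
  unfolding dir_deriv_def using frechet_derivative_at by metis

text \<open>The recursion clause of \<open>C_k\<close> with the derivative folded into \<open>dir_deriv\<close>, the form in
  which all inductions on the order of smoothness below use it.\<close>

lemma C_k_Suc_iff:
  "C_k (Suc k) f \<longleftrightarrow> (\<forall>p. f differentiable (at p)) \<and> (\<forall>v. C_k k (dir_deriv v f))"
  by (simp add: dir_deriv_def[abs_def])

lemma differentiable_has_dir_deriv:
  "f differentiable (at p) \<Longrightarrow> (f has_derivative (\<lambda>v. dir_deriv v f p)) (at p)"
  by (simp add: dir_deriv_def frechet_derivative_works[symmetric])

lemma dir_deriv_add:
  assumes "\<And>p. f differentiable (at p)" "\<And>p. g differentiable (at p)"
  shows "dir_deriv v (\<lambda>p. f p + g p) = (\<lambda>p. dir_deriv v f p + dir_deriv v g p)"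
  by (intro ext dir_deriv_eqI has_derivative_add differentiable_has_dir_deriv assms)

lemma dir_deriv_mult:
  fixes f g :: "'a::real_normed_vector \<Rightarrow> 'b::real_normed_algebra"
  assumes "\<And>p. f differentiable (at p)" "\<And>p. g differentiable (at p)"
  shows "dir_deriv v (\<lambda>p. f p * g p) = (\<lambda>p. f p * dir_deriv v g p + dir_deriv v f p * g p)"
  by (intro ext dir_deriv_eqI has_derivative_mult differentiable_has_dir_deriv assms)

lemma dir_deriv_bounded_linear_compose:
  assumes "bounded_linear L" "\<And>p. f differentiable (at p)"
  shows "dir_deriv v (\<lambda>p. L (f p)) = (\<lambda>p. L (dir_deriv v f p))"
  by (intro ext dir_deriv_eqI bounded_linear.has_derivative[OF assms(1)] differentiable_has_dir_deriv assms)

lemma dir_deriv_bounded_linear: "bounded_linear L \<Longrightarrow> dir_deriv v L = (\<lambda>p. L v)"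
  by (intro ext dir_deriv_eqI bounded_linear_imp_has_derivative)

lemma dir_deriv_const: "dir_deriv v (\<lambda>p. c) = (\<lambda>p. 0)"
  by (intro ext dir_deriv_eqI) auto

lemma dir_deriv_sum:
  assumes "\<And>i p. i \<in> A \<Longrightarrow> f i differentiable (at p)"
  shows "dir_deriv v (\<lambda>p. \<Sum>i\<in>A. f i p) = (\<lambda>p. \<Sum>i\<in>A. dir_deriv v (f i) p)"
  by (intro ext dir_deriv_eqI has_derivative_sum differentiable_has_dir_deriv assms)

lemma C_k_imp_continuous: "C_k k f \<Longrightarrow> continuous_on UNIV f"
  by (cases k) (auto simp: continuous_on_eq_continuous_at intro: differentiable_imp_continuous_within)

lemma C_k_Suc_imp: "C_k (Suc k) f \<Longrightarrow> C_k k f"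
proof (induction k arbitrary: f)
  case 0
  then show ?case using C_k_imp_continuous[of "Suc 0" f] by (simp del: C_k.simps(2))
next
  case (Suc k)
  then show ?case by (metis C_k_Suc_iff)
qed

lemma C_k_const: "C_k k (\<lambda>p. c)"
  by (induction k arbitrary: c) (auto simp: C_k_Suc_iff dir_deriv_const simp del: C_k.simps(2))

lemma C_k_bounded_linear: "bounded_linear L \<Longrightarrow> C_k k L"
  by (cases k)
     (auto simp: C_k_Suc_iff dir_deriv_bounded_linear C_k_const linear_continuous_on
                 bounded_linear_imp_differentiable simp del: C_k.simps(2))

lemma C_k_add: "C_k k f \<Longrightarrow> C_k k g \<Longrightarrow> C_k k (\<lambda>p. f p + g p)"
  by (induction k arbitrary: f g)
     (auto simp: C_k_Suc_iff dir_deriv_add continuous_on_add simp del: C_k.simps(2))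

lemma C_k_mult:
  fixes f g :: "'a::real_normed_vector \<Rightarrow> 'b::real_normed_algebra"
  shows "C_k k f \<Longrightarrow> C_k k g \<Longrightarrow> C_k k (\<lambda>p. f p * g p)"
proof (induction k arbitrary: f g)
  case 0
  then show ?case by (simp add: continuous_on_mult)
next
  case (Suc k)
  then have d: "\<And>p. f differentiable (at p)" "\<And>p. g differentiable (at p)"
    and c: "\<And>v. C_k k (dir_deriv v f)" "\<And>v. C_k k (dir_deriv v g)" "C_k k f" "C_k k g"
    by (auto simp: C_k_Suc_iff C_k_Suc_imp simp del: C_k.simps(2))
  show ?case
    unfolding C_k_Suc_iff dir_deriv_mult[OF d]
    by (auto intro!: C_k_add Suc.IH c d differentiable_mult)
qed

lemma C_k_bounded_linear_compose:
  "bounded_linear L \<Longrightarrow> C_k k f \<Longrightarrow> C_k k (\<lambda>p. L (f p))"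
proof (induction k arbitrary: f)
  case 0
  then show ?case by (simp add: bounded_linear.continuous_on)
next
  case (Suc k)
  have "(\<lambda>p. L (f p)) differentiable (at p)" for p
    using Suc.prems bounded_linear.has_derivative unfolding C_k_Suc_iff differentiable_def by blast
  with Suc show ?case
    by (auto simp: C_k_Suc_iff dir_deriv_bounded_linear_compose simp del: C_k.simps(2))
qed

lemma smooth_differentiable: "smooth f \<Longrightarrow> f differentiable (at p)"
  unfolding smooth_def by (metis C_k_Suc_iff)

lemma smooth_dir_deriv: "smooth f \<Longrightarrow> smooth (dir_deriv v f)"
  unfolding smooth_def by (metis C_k_Suc_iff)

lemma smooth_continuous: "smooth f \<Longrightarrow> continuous_on UNIV f"
  unfolding smooth_def by (metis C_k_imp_continuous)

lemma smooth_const: "smooth (\<lambda>p. c)"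
  by (simp add: smooth_def C_k_const)

lemma smooth_bounded_linear: "bounded_linear L \<Longrightarrow> smooth L"
  by (simp add: smooth_def C_k_bounded_linear)

lemma smooth_add: "smooth f \<Longrightarrow> smooth g \<Longrightarrow> smooth (\<lambda>p. f p + g p)"
  by (simp add: smooth_def C_k_add)

lemma smooth_mult:
  fixes f g :: "'a::real_normed_vector \<Rightarrow> 'b::real_normed_algebra"
  shows "smooth f \<Longrightarrow> smooth g \<Longrightarrow> smooth (\<lambda>p. f p * g p)"
  by (simp add: smooth_def C_k_mult)

lemma smooth_bounded_linear_compose:
  "bounded_linear L \<Longrightarrow> smooth f \<Longrightarrow> smooth (\<lambda>p. L (f p))"
  by (simp add: smooth_def C_k_bounded_linear_compose)

lemma smooth_sum: "(\<And>i. i \<in> A \<Longrightarrow> smooth (f i)) \<Longrightarrow> smooth (\<lambda>p. \<Sum>i\<in>A. f i p)"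
  by (induction A rule: infinite_finite_induct) (auto intro: smooth_const smooth_add)

lemma dir_deriv_smooth_mult:
  fixes c f :: "'a::real_normed_vector \<Rightarrow> complex"
  assumes "smooth c" "smooth f"
  shows "dir_deriv v (\<lambda>p. c p * f p) = (\<lambda>p. c p * dir_deriv v f p + dir_deriv v c p * f p)"
  by (intro dir_deriv_mult smooth_differentiable assms)

lemma dir_deriv_diff_smult:
  fixes f g :: "'a::real_normed_vector \<Rightarrow> complex"
  assumes "smooth f" "smooth g"
  shows "dir_deriv v (\<lambda>p. f p - c * g p) = (\<lambda>p. dir_deriv v f p - c * dir_deriv v g p)"
  by (intro ext dir_deriv_eqI has_derivative_diff has_derivative_mult_right
      differentiable_has_dir_deriv smooth_differentiable assms)

text \<open>Restricted to a line, the directional derivative becomes a derivative in one real variable. Through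
  this the one-dimensional mean value theorem gives both the symmetry of second derivatives and
  the domination needed under the integral sign.\<close>

lemma dir_deriv_line:
  assumes "\<And>p. f differentiable (at p)"
  shows "((\<lambda>s. f (p + s *\<^sub>R v)) has_vector_derivative dir_deriv v f (p + s *\<^sub>R v)) (at s within S)"
proof -
  let ?D = "\<lambda>w. dir_deriv w f (p + s *\<^sub>R v)"
  have D: "(f has_derivative ?D) (at (p + s *\<^sub>R v))"
    by (intro differentiable_has_dir_deriv assms)
  have "((\<lambda>s. p + s *\<^sub>R v) has_derivative (\<lambda>h. h *\<^sub>R v)) (at s within S)"
    by (auto intro!: derivative_eq_intros)
  from has_derivative_compose[OF this D]
  show ?thesis
    using linear_scale[OF has_derivative_linear[OF D]]
    by (simp add: has_vector_derivative_def)
qed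

text \<open>The mean value theorem is applied twice: to the increment in direction \<open>v\<close> as a function of the
  step in direction \<open>u\<close>, then to the derivative so obtained. The left-hand side does not change when
  \<open>u\<close> and \<open>v\<close> are swapped, the right-hand side has its derivatives taken in the other order.\<close>

lemma second_difference_real:
  fixes f :: "'a::real_normed_vector \<Rightarrow> real"
  assumes f: "\<And>p. f differentiable (at p)" "\<And>p. dir_deriv u f differentiable (at p)" and s: "0 < s"
  shows "\<exists>a\<in>{0..s}. \<exists>b\<in>{0..s}.
    f (p + s *\<^sub>R u + s *\<^sub>R v) - f (p + s *\<^sub>R u) - f (p + s *\<^sub>R v) + f p
      = s\<^sup>2 * dir_deriv v (dir_deriv u f) (p + a *\<^sub>R u + b *\<^sub>R v)"
proof -
  let ?g = "\<lambda>a. f ((p + s *\<^sub>R v) + a *\<^sub>R u) - f (p + a *\<^sub>R u)"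
  have "(?g has_derivative (\<lambda>h. h * (dir_deriv u f ((p + s *\<^sub>R v) + a *\<^sub>R u) - dir_deriv u f (p + a *\<^sub>R u))))
      (at a within {0..s})" for a
    using has_derivative_diff[OF dir_deriv_line[OF f(1), unfolded has_vector_derivative_def]
       dir_deriv_line[OF f(1), unfolded has_vector_derivative_def]]
    by (simp add: right_diff_distrib)
  from mvt_very_simple[OF less_imp_le[OF s] this]
  obtain a where a: "a \<in> {0..s}"
    "?g s - ?g 0 = s * (dir_deriv u f ((p + s *\<^sub>R v) + a *\<^sub>R u) - dir_deriv u f (p + a *\<^sub>R u))"
    by auto
  let ?h = "\<lambda>b. dir_deriv u f ((p + a *\<^sub>R u) + b *\<^sub>R v)"
  have "(?h has_derivative (\<lambda>h. h * dir_deriv v (dir_deriv u f) ((p + a *\<^sub>R u) + b *\<^sub>R v)))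
      (at b within {0..s})" for b
    using dir_deriv_line[OF f(2), unfolded has_vector_derivative_def] by simp
  from mvt_very_simple[OF less_imp_le[OF s] this]
  obtain b where b: "b \<in> {0..s}"
    "?h s - ?h 0 = s * dir_deriv v (dir_deriv u f) ((p + a *\<^sub>R u) + b *\<^sub>R v)"
    by auto
  have "?g s - ?g 0 = s * (?h s - ?h 0)"
    using a(2) by (simp add: add.assoc add.commute add.left_commute)
  then show ?thesis
    using a(1) b by (intro bexI[of _ a] bexI[of _ b])
       (auto simp: power2_eq_square algebra_simps)
qed

lemma second_difference_limit_real:
  fixes f :: "'a::real_normed_vector \<Rightarrow> real"
  assumes f: "smooth f"
  shows "(\<lambda>n. (f (p + inverse (real (Suc n)) *\<^sub>R u + inverse (real (Suc n)) *\<^sub>R v)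
        - f (p + inverse (real (Suc n)) *\<^sub>R u) - f (p + inverse (real (Suc n)) *\<^sub>R v) + f p)
        / (inverse (real (Suc n)))\<^sup>2) \<longlonglongrightarrow> dir_deriv v (dir_deriv u f) p"
proof -
  let ?s = "\<lambda>n. inverse (real (Suc n))"
  have "\<forall>n. \<exists>a b. 0 \<le> a \<and> a \<le> ?s n \<and> 0 \<le> b \<and> b \<le> ?s n \<and>
     f (p + ?s n *\<^sub>R u + ?s n *\<^sub>R v) - f (p + ?s n *\<^sub>R u) - f (p + ?s n *\<^sub>R v) + f p
      = (?s n)\<^sup>2 * dir_deriv v (dir_deriv u f) (p + a *\<^sub>R u + b *\<^sub>R v)"
  proof
    fix n
    have "0 < ?s n" by simp
    from second_difference_real[OF smooth_differentiable[OF f]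
        smooth_differentiable[OF smooth_dir_deriv[OF f]] this, where p = p and u = u and v = v]
    obtain a b where "a \<in> {0..?s n}" "b \<in> {0..?s n}" and
      "f (p + ?s n *\<^sub>R u + ?s n *\<^sub>R v) - f (p + ?s n *\<^sub>R u) - f (p + ?s n *\<^sub>R v) + f p
      = (?s n)\<^sup>2 * dir_deriv v (dir_deriv u f) (p + a *\<^sub>R u + b *\<^sub>R v)"
      by (elim bexE)
    then show "\<exists>a b. 0 \<le> a \<and> a \<le> ?s n \<and> 0 \<le> b \<and> b \<le> ?s n \<and>
     f (p + ?s n *\<^sub>R u + ?s n *\<^sub>R v) - f (p + ?s n *\<^sub>R u) - f (p + ?s n *\<^sub>R v) + f p
      = (?s n)\<^sup>2 * dir_deriv v (dir_deriv u f) (p + a *\<^sub>R u + b *\<^sub>R v)"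
      unfolding atLeastAtMost_iff by (intro exI[of _ a] exI[of _ b] conjI) (elim conjE, assumption)+
  qed
  then obtain a b where ab: "\<And>n. 0 \<le> a n" "\<And>n. a n \<le> ?s n" "\<And>n. 0 \<le> b n" "\<And>n. b n \<le> ?s n"
    and eq: "\<And>n. f (p + ?s n *\<^sub>R u + ?s n *\<^sub>R v) - f (p + ?s n *\<^sub>R u) - f (p + ?s n *\<^sub>R v) + f p
      = (?s n)\<^sup>2 * dir_deriv v (dir_deriv u f) (p + a n *\<^sub>R u + b n *\<^sub>R v)"
    unfolding choice_iff by (elim exE) blast
  have "a \<longlonglongrightarrow> 0" "b \<longlonglongrightarrow> 0"
    using tendsto_sandwich[OF always_eventually always_eventually tendsto_const LIMSEQ_inverse_real_of_nat] ab
    by blast+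
  then have "(\<lambda>n. p + a n *\<^sub>R u + b n *\<^sub>R v) \<longlonglongrightarrow> p + 0 *\<^sub>R u + 0 *\<^sub>R v"
    by (intro tendsto_intros)
  then have lim: "(\<lambda>n. p + a n *\<^sub>R u + b n *\<^sub>R v) \<longlonglongrightarrow> p" by simp
  have cont: "isCont (dir_deriv v (dir_deriv u f)) p"
    using smooth_continuous[OF smooth_dir_deriv[OF smooth_dir_deriv[OF f]]]
    by (simp add: continuous_on_eq_continuous_at)
  show ?thesis using isCont_tendsto_compose[OF cont lim] by (simp add: eq del: of_nat_Suc)
qed

lemma dir_deriv_commute_real:
  fixes f :: "'a::real_normed_vector \<Rightarrow> real"
  assumes "smooth f"
  shows "dir_deriv v (dir_deriv u f) = dir_deriv u (dir_deriv v f)"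
proof
  fix p
  show "dir_deriv v (dir_deriv u f) p = dir_deriv u (dir_deriv v f) p"
    using second_difference_limit_real[OF assms, of p u v]
      second_difference_limit_real[OF assms, of p v u]
    by (intro LIMSEQ_unique) (assumption, simp add: algebra_simps)
qed

text \<open>The mean value theorem needs real values, so the symmetry is transferred to complex functions
  through real and imaginary parts.\<close>

lemma dir_deriv_commute:
  fixes f :: "'a::real_normed_vector \<Rightarrow> complex"
  assumes f: "smooth f"
  shows "dir_deriv v (dir_deriv u f) = dir_deriv u (dir_deriv v f)"
proof
  fix p
  have part: "L (dir_deriv v (dir_deriv u f) p) = L (dir_deriv u (dir_deriv v f) p)"
    if L: "bounded_linear L" for L :: "complex \<Rightarrow> real"
  proof -
    have "dir_deriv w (dir_deriv w' (\<lambda>p. L (f p))) = (\<lambda>p. L (dir_deriv w (dir_deriv w' f) p))" for w w'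
      by (simp add: dir_deriv_bounded_linear_compose[OF L] smooth_differentiable smooth_dir_deriv f)
    with dir_deriv_commute_real[OF smooth_bounded_linear_compose[OF L f]] show ?thesis
      by metis
  qed
  show "dir_deriv v (dir_deriv u f) p = dir_deriv u (dir_deriv v f) p"
    by (intro complex_eqI part bounded_linear_Re bounded_linear_Im)
qed

section \<open>Closure properties of test functions\<close>

lemma test_functionsD:
  assumes "f \<in> test_functions \<Omega>"
  shows "smooth f" "compact (closure {p. f p \<noteq> 0})" "closure {p. f p \<noteq> 0} \<subseteq> \<Omega>"
  using assms by (auto simp: test_functions_def)

text \<open>All closure properties of test functions that do not enlarge the support reduce to smoothness
  by this lemma.\<close>

lemma test_functions_smaller_support:
  assumes f: "f \<in> test_functions \<Omega>" and g: "smooth g" "{p. g p \<noteq> 0} \<subseteq> closure {p. f p \<noteq> 0}"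
  shows "g \<in> test_functions \<Omega>"
proof -
  have sub: "closure {p. g p \<noteq> 0} \<subseteq> closure {p. f p \<noteq> 0}"
    using g(2) by (rule closure_minimal) simp
  then have "compact (closure {p. g p \<noteq> 0})"
    using test_functionsD(2)[OF f] compact_Int_closed closed_closure by (metis inf.absorb2)
  then show ?thesis
    using sub test_functionsD[OF f] g(1) by (auto simp: test_functions_def)
qed

lemma compact_closure_subset: "compact K \<Longrightarrow> closure S \<subseteq> K \<Longrightarrow> compact (closure S)"
  using compact_Int_closed[of K "closure S"] by (simp add: Int_absorb1)

lemma in_support: "f p \<noteq> 0 \<Longrightarrow> p \<in> closure {p. f p \<noteq> 0}"
  by (rule subsetD[OF closure_subset]) simp

lemma support_subsetI: "(\<And>p. f p = 0 \<Longrightarrow> g p = 0) \<Longrightarrow> {p. g p \<noteq> 0} \<subseteq> closure {p. f p \<noteq> 0}"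
  by (rule order_trans[OF _ closure_subset]) auto

lemma vanishes_near:
  assumes "p \<notin> closure {p. f p \<noteq> (0::'b::real_normed_vector)}"
  shows "eventually (\<lambda>q. f q = 0) (nhds p)"
proof -
  have "eventually (\<lambda>q. q \<in> - closure {p. f p \<noteq> 0}) (nhds p)"
    using assms by (intro eventually_nhds_in_open) auto
  then show ?thesis
    by (rule eventually_mono) (metis ComplD in_support)
qed

lemma has_derivative_zero_of_eventually:
  assumes "eventually (\<lambda>q. f q = 0) (nhds p)"
  shows "(f has_derivative (\<lambda>v. 0)) (at p)"
proof (rule has_derivative_transform_eventually[of "\<lambda>q. 0"])
  show "\<forall>\<^sub>F q in at p. 0 = f q"
    unfolding eventually_at_filter using assms by (rule eventually_mono) simp
  show "0 = f p"
    using eventually_nhds_x_imp_x[OF assms] by simp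
qed auto

lemma dir_deriv_outside_support:
  assumes "p \<notin> closure {p. f p \<noteq> 0}"
  shows "dir_deriv v f p = 0"
  using dir_deriv_eqI[OF has_derivative_zero_of_eventually[OF vanishes_near[OF assms]]] .

lemma test_functions_dir_deriv:
  assumes f: "f \<in> test_functions \<Omega>"
  shows "dir_deriv v f \<in> test_functions \<Omega>"
proof (rule test_functions_smaller_support[OF f])
  show "smooth (dir_deriv v f)" by (rule smooth_dir_deriv[OF test_functionsD(1)[OF f]])
  show "{p. dir_deriv v f p \<noteq> 0} \<subseteq> closure {p. f p \<noteq> 0}"
    using dir_deriv_outside_support[of _ f v] by blast
qed

lemma test_functions_zero: "(\<lambda>p. 0) \<in> test_functions \<Omega>"
  by (simp add: test_functions_def smooth_const)

lemma test_functions_add: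
  assumes f: "f \<in> test_functions \<Omega>" and g: "g \<in> test_functions \<Omega>"
  shows "(\<lambda>p. f p + g p) \<in> test_functions \<Omega>"
proof -
  have sub: "closure {p. f p + g p \<noteq> 0} \<subseteq> closure {p. f p \<noteq> 0} \<union> closure {p. g p \<noteq> 0}"
    unfolding closure_Un[symmetric] by (rule closure_mono) auto
  have "compact (closure {p. f p \<noteq> 0} \<union> closure {p. g p \<noteq> 0})"
    by (intro compact_Un test_functionsD[OF f] test_functionsD[OF g])
  then have "compact (closure {p. f p + g p \<noteq> 0})"
    using sub by (rule compact_closure_subset)
  moreover have "closure {p. f p + g p \<noteq> 0} \<subseteq> \<Omega>"
    using sub test_functionsD(3)[OF f] test_functionsD(3)[OF g] by (meson Un_least order_trans)
  ultimately show ?thesis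
    using smooth_add[OF test_functionsD(1)[OF f] test_functionsD(1)[OF g]]
    by (simp add: test_functions_def)
qed

lemma test_functions_mult:
  assumes "smooth c" "f \<in> test_functions \<Omega>"
  shows "(\<lambda>p. c p * f p) \<in> test_functions \<Omega>"
  using assms(2)
proof (rule test_functions_smaller_support)
  show "smooth (\<lambda>p. c p * f p)"
    by (intro smooth_mult assms test_functionsD(1)[OF assms(2)])
  show "{p. c p * f p \<noteq> 0} \<subseteq> closure {p. f p \<noteq> 0}"
    by (rule support_subsetI) simp
qed

lemma test_functions_smult: "f \<in> test_functions \<Omega> \<Longrightarrow> (\<lambda>p. c * f p) \<in> test_functions \<Omega>"
  by (rule test_functions_mult[OF smooth_const])

lemma test_functions_diff:
  "f \<in> test_functions \<Omega> \<Longrightarrow> g \<in> test_functions \<Omega> \<Longrightarrow> (\<lambda>p. f p - g p) \<in> test_functions \<Omega>"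
  using test_functions_add[OF _ test_functions_smult[of _ _ "-1"], of f \<Omega> g] by simp

lemma test_functions_cnj:
  assumes "f \<in> test_functions \<Omega>"
  shows "(\<lambda>p. cnj (f p)) \<in> test_functions \<Omega>"
  using assms
proof (rule test_functions_smaller_support)
  show "smooth (\<lambda>p. cnj (f p))"
    by (rule smooth_bounded_linear_compose[OF bounded_linear_cnj test_functionsD(1)[OF assms]])
  show "{p. cnj (f p) \<noteq> 0} \<subseteq> closure {p. f p \<noteq> 0}"
    by (rule support_subsetI) simp
qed

lemma test_functions_sum:
  "(\<And>i. i \<in> A \<Longrightarrow> f i \<in> test_functions \<Omega>) \<Longrightarrow> (\<lambda>p. \<Sum>i\<in>A. f i p) \<in> test_functions \<Omega>"
  by (induction A rule: infinite_finite_induct) (auto intro: test_functions_zero test_functions_add)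

text \<open>The quotient rule holds on all of the space although \<open>q\<close> may vanish off \<open>\<Omega>\<close>: outside the support of
  \<open>f\<close>, hence wherever \<open>q\<close> vanishes, the quotient is locally zero.\<close>

lemma has_derivative_divide_test_function:
  fixes q :: "'a::real_normed_vector \<Rightarrow> complex"
  assumes f: "f \<in> test_functions \<Omega>" and q: "smooth q" "\<And>p. p \<in> \<Omega> \<Longrightarrow> q p \<noteq> 0"
  shows "((\<lambda>p. f p / q p) has_derivative (\<lambda>v. dir_deriv v f p / q p - dir_deriv v q p * f p / (q p)\<^sup>2)) (at p)"
proof (cases "p \<in> \<Omega>")
  case True
  with q(2) have q0: "q p \<noteq> 0" by simp
  show ?thesis
    using has_derivative_divide[OF
        differentiable_has_dir_deriv[OF smooth_differentiable[OF test_functionsD(1)[OF f]]]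
        differentiable_has_dir_deriv[OF smooth_differentiable[OF q(1)]] q0]
    by (rule has_derivative_eq_rhs) (use q0 in \<open>auto simp: field_simps power2_eq_square\<close>)
next
  case False
  then have p: "p \<notin> closure {p. f p \<noteq> 0}"
    using test_functionsD[OF f] by auto
  then have ev: "eventually (\<lambda>q'. f q' / q q' = 0) (nhds p)"
    using vanishes_near[OF p] by (auto elim: eventually_mono)
  have "f p = 0" using p in_support[of f] by blast
  then show ?thesis
    using has_derivative_zero_of_eventually[OF ev] by (simp add: dir_deriv_outside_support[OF p])
qed

lemma dir_deriv_divide_test_function:
  fixes q :: "'a::real_normed_vector \<Rightarrow> complex"
  assumes "f \<in> test_functions \<Omega>" "smooth q" "\<And>p. p \<in> \<Omega> \<Longrightarrow> q p \<noteq> 0"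
  shows "dir_deriv v (\<lambda>p. f p / q p)
    = (\<lambda>p. dir_deriv v f p / q p - dir_deriv v q p * f p / (q p)\<^sup>2)"
  by (rule ext, rule dir_deriv_eqI, rule has_derivative_divide_test_function[OF assms])

text \<open>The power \<open>m\<close> is what makes the induction on \<open>k\<close> go through: differentiating the quotient
  gives two quotients of test functions, one of them with denominator \<open>q ^ (2 * m)\<close>.\<close>

lemma C_k_divide_test_function:
  fixes q :: "'a::real_normed_vector \<Rightarrow> complex"
  assumes q: "smooth q" "\<And>p. p \<in> \<Omega> \<Longrightarrow> q p \<noteq> 0" and f: "f \<in> test_functions \<Omega>"
  shows "C_k k (\<lambda>p. f p / q p ^ m)"
  using f
proof (induction k arbitrary: f m)
  case 0
  have qm: "smooth (\<lambda>p. q p ^ m)"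
    by (induction m) (auto intro: smooth_const smooth_mult q)
  have "(\<lambda>p. f p / q p ^ m) differentiable (at p)" for p
    by (rule differentiableI[OF has_derivative_divide_test_function[OF 0 qm]]) (simp add: q(2))
  then show ?case
    by (auto simp: continuous_on_eq_continuous_at intro: differentiable_imp_continuous_within)
next
  case (Suc k)
  have qm: "smooth (\<lambda>p. q p ^ m)" for m
    by (induction m) (auto intro: smooth_const smooth_mult q)
  have D: "((\<lambda>p. f p / q p ^ m) has_derivative (\<lambda>v. dir_deriv v f p / q p ^ m -
       dir_deriv v (\<lambda>p. q p ^ m) p * f p / (q p ^ m)\<^sup>2)) (at p)" for p
    by (rule has_derivative_divide_test_function[OF Suc.prems qm]) (simp add: q)
  have E: "dir_deriv v (\<lambda>p. f p / q p ^ m)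
     = (\<lambda>p. dir_deriv v f p / q p ^ m + - (dir_deriv v (\<lambda>p. q p ^ m) p * f p) / q p ^ (2 * m))" for v
    by (intro ext trans[OF dir_deriv_eqI[OF D]]) (simp add: power_mult[symmetric] mult.commute)
  have F: "C_k k (\<lambda>p. - (dir_deriv v (\<lambda>p. q p ^ m) p * f p) / q p ^ (2 * m))" for v
    using test_functions_mult[OF smooth_const[of "-1"] test_functions_mult[OF smooth_dir_deriv[OF qm] Suc.prems]]
    by (intro Suc.IH) simp
  have G: "C_k k (\<lambda>p. dir_deriv v f p / q p ^ m)" for v
    by (rule Suc.IH[OF test_functions_dir_deriv[OF Suc.prems]])
  show ?case
    unfolding C_k_Suc_iff E by (intro conjI allI C_k_add F G differentiableI[OF D])
qed

lemma test_functions_divide: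
  fixes q :: "'a::real_normed_vector \<Rightarrow> complex"
  assumes q: "smooth q" "\<And>p. p \<in> \<Omega> \<Longrightarrow> q p \<noteq> 0" and f: "f \<in> test_functions \<Omega>"
  shows "(\<lambda>p. f p / q p) \<in> test_functions \<Omega>"
proof (rule test_functions_smaller_support[OF f])
  show "smooth (\<lambda>p. f p / q p)"
    using C_k_divide_test_function[OF assms, where m = 1] by (simp add: smooth_def)
  show "{p. f p / q p \<noteq> 0} \<subseteq> closure {p. f p \<noteq> 0}"
    by (rule support_subsetI) simp
qed

section \<open>Integrals of derivatives of test functions\<close>

lemma integrable_test_function:
  fixes f :: "'a::euclidean_space \<Rightarrow> complex"
  assumes f: "f \<in> test_functions \<Omega>"
  shows "integrable lborel f"
proof -
  have "integrable lborel (\<lambda>x. indicator (closure {p. f p \<noteq> 0}) x *\<^sub>R f x)"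
    by (rule borel_integrable_compact[OF test_functionsD(2)[OF f]
          continuous_on_subset[OF smooth_continuous[OF test_functionsD(1)[OF f]] subset_UNIV]])
  also have "(\<lambda>x. indicator (closure {p. f p \<noteq> 0}) x *\<^sub>R f x) = f"
    by (intro ext) (metis in_support indicator_simps scaleR_one scaleR_zero_right scaleR_zero_left)
  finally show ?thesis .
qed

text \<open>This is translation invariance of Lebesgue measure.\<close>

lemma integral_difference_quotient_eq_zero:
  fixes f :: "'a::euclidean_space \<Rightarrow> complex"
  assumes f: "f \<in> test_functions \<Omega>"
  shows "(LINT p|lborel. (f (p + v) - f p) /\<^sub>R s) = 0"
proof -
  have fb: "f \<in> borel_measurable borel"
    using integrable_test_function[OF f] by auto
  have I: "(LINT p|lborel. f (v + p)) = (LINT p|lborel. f p)"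
    using integral_distr[of "(+) v" lborel borel f] fb by (simp add: lborel_distr_plus)
  have J: "integrable lborel (\<lambda>p. f (v + p))"
    using integrable_distr_eq[of "(+) v" lborel borel f] fb integrable_test_function[OF f]
    by (simp add: lborel_distr_plus)
  show ?thesis
    using I J integrable_test_function[OF f] by (simp add: add.commute)
qed

lemma test_function_bounded:
  fixes f :: "'a::real_normed_vector \<Rightarrow> complex"
  assumes f: "f \<in> test_functions \<Omega>"
  shows "\<exists>M\<ge>0. \<forall>p. norm (f p) \<le> M"
proof -
  let ?K = "closure {p. f p \<noteq> 0}"
  have "compact (f ` ?K)"
    using continuous_on_subset[OF smooth_continuous[OF test_functionsD(1)[OF f]] subset_UNIV]
      test_functionsD(2)[OF f] by (rule compact_continuous_image)
  from compact_imp_bounded[OF this]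
  obtain M where M: "0 < M" "\<forall>z \<in> f ` ?K. norm z \<le> M"
    unfolding bounded_pos by (elim exE conjE)
  have "norm (f p) \<le> M" for p
  proof (cases "f p = 0")
    case True
    with M(1) show ?thesis by simp
  next
    case False
    then have "p \<in> ?K" by (rule in_support)
    with M(2) show ?thesis by (metis imageI)
  qed
  with M(1) show ?thesis by (intro exI[of _ M]) simp
qed

lemma norm_increment_le:
  fixes f :: "'a::real_normed_vector \<Rightarrow> complex"
  assumes diff: "\<And>p. f differentiable (at p)" and M: "\<And>p. norm (dir_deriv v f p) \<le> M"
    and s: "0 \<le> s"
  shows "norm (f (p + s *\<^sub>R v) - f p) \<le> M * s"
proof -
  have "norm (f (p + s *\<^sub>R v) - f (p + 0 *\<^sub>R v)) \<le> M * norm (s - 0)"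
  proof (rule differentiable_bound[where S = "{0..s}" and f = "\<lambda>s. f (p + s *\<^sub>R v)"])
    show "((\<lambda>s. f (p + s *\<^sub>R v)) has_derivative (\<lambda>h. h *\<^sub>R dir_deriv v f (p + t *\<^sub>R v))) (at t within {0..s})" for t
      using dir_deriv_line[OF diff] unfolding has_vector_derivative_def .
    show "onorm (\<lambda>h. h *\<^sub>R dir_deriv v f (p + t *\<^sub>R v)) \<le> M" for t
      by (rule onorm_le) (simp add: mult.commute[of M] mult_left_mono[OF M])
  qed (use s in auto)
  then show ?thesis using s by simp
qed

lemma has_vector_derivative_quotient_limit:
  assumes "(g has_vector_derivative D) (at 0)"
  shows "((\<lambda>s. (g s - g 0) /\<^sub>R s) \<longlongrightarrow> D) (at 0)"
proof -
  have "((\<lambda>s. norm (g s - g 0 - s *\<^sub>R D) / norm s) \<longlongrightarrow> 0) (at 0)"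
    using assms by (simp add: has_vector_derivative_def has_derivative_at)
  then have "((\<lambda>s. norm ((g s - g 0) /\<^sub>R s - D)) \<longlongrightarrow> 0) (at 0)"
  proof (rule Lim_transform_eventually)
    have "norm (g s - g 0 - s *\<^sub>R D) / norm s = norm ((g s - g 0) /\<^sub>R s - D)" if "s \<noteq> 0" for s
    proof -
      have "(g s - g 0) /\<^sub>R s - D = (g s - g 0 - s *\<^sub>R D) /\<^sub>R s"
        using that by (simp add: scaleR_diff_right)
      then show ?thesis by (simp add: divide_inverse mult.commute)
    qed
    then show "\<forall>\<^sub>F s in at 0. norm (g s - g 0 - s *\<^sub>R D) / norm s = norm ((g s - g 0) /\<^sub>R s - D)"
      by (auto simp: eventually_at_filter)
  qed
  then show ?thesis
    using LIM_zero_cancel tendsto_norm_zero_iff by blast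
qed

text \<open>The difference quotients of \<open>f\<close> all have integral zero and converge to the directional
  derivative. They are supported in one common ball and bounded by the supremum of the derivative, so dominated
  convergence applies.\<close>

theorem integral_dir_deriv_eq_zero:
  fixes f :: "'a::euclidean_space \<Rightarrow> complex"
  assumes f: "f \<in> test_functions \<Omega>"
  shows "(LINT p|lborel. dir_deriv v f p) = 0"
proof -
  let ?s = "\<lambda>n. inverse (real (Suc n))"
  let ?K = "closure {p. f p \<noteq> 0}"
  have diff: "\<And>p. f differentiable (at p)"
    using smooth_differentiable[OF test_functionsD(1)[OF f]] .
  obtain M where M: "0 \<le> M" "\<And>p. norm (dir_deriv v f p) \<le> M"
    using test_function_bounded[OF test_functions_dir_deriv[OF f, of v]] by (elim exE conjE) simp
  obtain R where R: "\<forall>p \<in> ?K. norm p \<le> R"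
    using compact_imp_bounded[OF test_functionsD(2)[OF f]] unfolding bounded_iff by blast
  \<comment> \<open>The displacements are at most \<open>norm v\<close> long, so every quotient vanishes outside this ball.\<close>
  let ?B = "cball (0::'a) (R + norm v)"
  let ?q = "\<lambda>n p. (f (p + ?s n *\<^sub>R v) - f p) /\<^sub>R ?s n"
  have zero: "f p = 0" if "norm p > R" for p
  proof (rule ccontr)
    assume "f p \<noteq> 0"
    then have "p \<in> ?K" by (rule in_support)
    with R that show False by fastforce
  qed
  have bound: "norm (?q n p) \<le> indicator ?B p *\<^sub>R M" for n p
  proof (cases "p \<in> ?B")
    case True
    have "norm (f (p + ?s n *\<^sub>R v) - f p) \<le> M * ?s n"
      by (rule norm_increment_le[OF diff M(2)]) simp
    then have "norm (?q n p) \<le> M"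
      by (simp add: divide_simps mult.commute del: of_nat_Suc)
    with True show ?thesis by simp
  next
    case False
    then have p: "norm p > R + norm v" by simp
    have "norm (?s n *\<^sub>R v) \<le> 1 * norm v"
      unfolding norm_scaleR by (intro mult_right_mono) (auto simp: divide_simps)
    with p have "norm (p + ?s n *\<^sub>R v) > R"
      using norm_diff_ineq[of p "?s n *\<^sub>R v"] by linarith
    moreover have "norm p > R" using p norm_ge_zero[of v] by linarith
    ultimately show ?thesis using False by (simp add: zero del: of_nat_Suc)
  qed
  have lim: "(\<lambda>n. ?q n p) \<longlonglongrightarrow> dir_deriv v f p" for p
  proof -
    have "((\<lambda>s. f (p + s *\<^sub>R v)) has_vector_derivative dir_deriv v f p) (at 0)"
      using dir_deriv_line[OF diff, of p v 0 UNIV] by simp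
    from has_vector_derivative_quotient_limit[OF this]
    have "((\<lambda>s. (f (p + s *\<^sub>R v) - f p) /\<^sub>R s) \<longlongrightarrow> dir_deriv v f p) (at 0)"
      by simp
    moreover have "filterlim ?s (at 0) sequentially"
      unfolding filterlim_at using LIMSEQ_inverse_real_of_nat by auto
    ultimately show ?thesis by (rule filterlim_compose)
  qed
  have [measurable]: "f \<in> borel_measurable borel"
    using integrable_test_function[OF f] by auto
  have "(\<lambda>n. LINT p|lborel. ?q n p) \<longlonglongrightarrow> (LINT p|lborel. dir_deriv v f p)"
  proof (rule integral_dominated_convergence[where w = "\<lambda>p. indicator ?B p *\<^sub>R M"])
    show "dir_deriv v f \<in> borel_measurable lborel"
      using integrable_test_function[OF test_functions_dir_deriv[OF f]] by auto
    show "?q n \<in> borel_measurable lborel" for n by measurable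
    show "integrable lborel (\<lambda>p. indicator ?B p *\<^sub>R M)"
      by (rule borel_integrable_compact) auto
    show "AE p in lborel. norm (?q n p) \<le> indicator ?B p *\<^sub>R M" for n
      using bound by (intro always_eventually allI)
    show "AE p in lborel. (\<lambda>n. ?q n p) \<longlonglongrightarrow> dir_deriv v f p"
      using lim by (intro always_eventually allI)
  qed
  then have "(\<lambda>n. 0) \<longlonglongrightarrow> (LINT p|lborel. dir_deriv v f p)"
    by (simp only: integral_difference_quotient_eq_zero[OF f])
  then show ?thesis
    using LIMSEQ_unique tendsto_const by blast
qed

section \<open>The inner product on test functions\<close>

text \<open>The inner product of \<open>L^2\<close>, linear in its first argument.\<close>

definition L2_inner :: "('a::euclidean_space \<Rightarrow> complex) \<Rightarrow> ('a \<Rightarrow> complex) \<Rightarrow> complex" where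
  "L2_inner g h = (LINT p|lborel. g p * cnj (h p))"

lemma test_functions_mult_cnj:
  assumes "g \<in> test_functions \<Omega>" "h \<in> test_functions \<Omega>"
  shows "(\<lambda>p. g p * cnj (h p)) \<in> test_functions \<Omega>"
  by (rule test_functions_mult[OF test_functionsD(1)[OF assms(1)] test_functions_cnj[OF assms(2)]])

lemma integrable_mult_cnj:
  fixes g h :: "'a::euclidean_space \<Rightarrow> complex"
  assumes "g \<in> test_functions \<Omega>" "h \<in> test_functions \<Omega>"
  shows "integrable lborel (\<lambda>p. g p * cnj (h p))"
  by (rule integrable_test_function[OF test_functions_mult_cnj[OF assms]])

lemma L2_inner_add_left:
  "\<lbrakk>f \<in> test_functions \<Omega>; g \<in> test_functions \<Omega>; h \<in> test_functions \<Omega>\<rbrakk>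
    \<Longrightarrow> L2_inner (\<lambda>p. f p + g p) h = L2_inner f h + L2_inner g h"
  by (simp add: L2_inner_def distrib_right integrable_mult_cnj)

lemma L2_inner_diff_left:
  "\<lbrakk>f \<in> test_functions \<Omega>; g \<in> test_functions \<Omega>; h \<in> test_functions \<Omega>\<rbrakk>
    \<Longrightarrow> L2_inner (\<lambda>p. f p - g p) h = L2_inner f h - L2_inner g h"
  by (simp add: L2_inner_def left_diff_distrib integrable_mult_cnj)

lemma L2_inner_add_right:
  "\<lbrakk>f \<in> test_functions \<Omega>; g \<in> test_functions \<Omega>; h \<in> test_functions \<Omega>\<rbrakk>
    \<Longrightarrow> L2_inner h (\<lambda>p. f p + g p) = L2_inner h f + L2_inner h g"
  by (simp add: L2_inner_def distrib_left integrable_mult_cnj)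

lemma L2_inner_diff_right:
  "\<lbrakk>f \<in> test_functions \<Omega>; g \<in> test_functions \<Omega>; h \<in> test_functions \<Omega>\<rbrakk>
    \<Longrightarrow> L2_inner h (\<lambda>p. f p - g p) = L2_inner h f - L2_inner h g"
  by (simp add: L2_inner_def right_diff_distrib integrable_mult_cnj)

lemma L2_inner_sum_left:
  "(\<And>i. i \<in> A \<Longrightarrow> f i \<in> test_functions \<Omega>) \<Longrightarrow> h \<in> test_functions \<Omega>
    \<Longrightarrow> L2_inner (\<lambda>p. \<Sum>i\<in>A. f i p) h = (\<Sum>i\<in>A. L2_inner (f i) h)"
  unfolding L2_inner_def sum_distrib_right
  by (rule Bochner_Integration.integral_sum) (rule integrable_mult_cnj)

lemma L2_inner_sum_right:
  "(\<And>i. i \<in> A \<Longrightarrow> f i \<in> test_functions \<Omega>) \<Longrightarrow> h \<in> test_functions \<Omega>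
    \<Longrightarrow> L2_inner h (\<lambda>p. \<Sum>i\<in>A. f i p) = (\<Sum>i\<in>A. L2_inner h (f i))"
  unfolding L2_inner_def cnj_sum sum_distrib_left
  by (rule Bochner_Integration.integral_sum) (rule integrable_mult_cnj)

text \<open>Integration by parts: the derivative of \<open>g * cnj h\<close> has integral zero.\<close>

lemma L2_inner_dir_deriv:
  assumes g: "g \<in> test_functions \<Omega>" and h: "h \<in> test_functions \<Omega>"
  shows "L2_inner (dir_deriv v g) h = - L2_inner g (dir_deriv v h)"
proof -
  note gs = test_functionsD(1)[OF g] and hs = test_functionsD(1)[OF h]
  have c: "dir_deriv v (\<lambda>p. cnj (h p)) = (\<lambda>p. cnj (dir_deriv v h p))"
    by (rule dir_deriv_bounded_linear_compose[OF bounded_linear_cnj smooth_differentiable[OF hs]])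
  have "dir_deriv v (\<lambda>p. g p * cnj (h p)) = (\<lambda>p. g p * cnj (dir_deriv v h p) + dir_deriv v g p * cnj (h p))"
    using dir_deriv_mult[OF smooth_differentiable[OF gs]
        smooth_differentiable[OF test_functionsD(1)[OF test_functions_cnj[OF h]]], of v]
    by (simp only: c)
  with integral_dir_deriv_eq_zero[OF test_functions_mult_cnj[OF g h], of v]
  have "(LINT p|lborel. g p * cnj (dir_deriv v h p) + dir_deriv v g p * cnj (h p)) = 0" by simp
  then show ?thesis
    using integrable_mult_cnj[OF g test_functions_dir_deriv[OF h]]
      integrable_mult_cnj[OF test_functions_dir_deriv[OF g] h]
    by (simp add: L2_inner_def add_eq_0_iff)
qed

lemma L2_inner_const_left: "L2_inner (\<lambda>p. c * g p) h = c * L2_inner g h"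
  by (simp add: L2_inner_def mult.assoc)

lemma L2_inner_const_right: "L2_inner g (\<lambda>p. c * h p) = cnj c * L2_inner g h"
  by (simp add: L2_inner_def mult.left_commute)

lemma cnj_L2_inner: "cnj (L2_inner g h) = L2_inner h g"
proof -
  have "cnj (L2_inner g h) = (LINT p|lborel. cnj (g p * cnj (h p)))"
    unfolding L2_inner_def by (rule Bochner_Integration.integral_cnj[symmetric])
  then show ?thesis by (simp add: L2_inner_def mult.commute)
qed

lemma Re_L2_inner_commute: "Re (L2_inner g h) = Re (L2_inner h g)"
  by (metis cnj_L2_inner cnj.sel(1))

lemma L2_inner_move: "(\<And>p. cnj (c p) = c p) \<Longrightarrow> L2_inner (\<lambda>p. c p * g p) h = L2_inner g (\<lambda>p. c p * h p)"
  by (simp add: L2_inner_def mult.left_commute mult.assoc)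

lemma L2_inner_self: "L2_inner g g = of_real (LINT p|lborel. (norm (g p))\<^sup>2)"
  unfolding L2_inner_def integral_complex_of_real[symmetric] by (simp only: complex_norm_square)

section \<open>Horizontal fields in uniform notation\<close>

text \<open>The fields \<open>X_j\<close> and \<open>Y_j\<close> are treated uniformly, indexed by the disjoint sum \<open>'n + 'n\<close> (left for \<open>X\<close>,
  right for \<open>Y\<close>). Coordinates are complex valued to avoid coercions in products.\<close>

definition hcoord :: "'n + 'n \<Rightarrow> 'n::finite heis \<Rightarrow> complex" where
  "hcoord k p = (case k of Inl j \<Rightarrow> of_real (fst p $ j) | Inr j \<Rightarrow> of_real (fst (snd p) $ j))"

text \<open>The horizontal point rotated by a quarter turn in each plane \<open>(x_j, y_j)\<close>. It is at once the
  coefficient of \<open>- T / 2\<close> in the horizontal fields and, up to sign, the coefficient vector of \<open>Z\<close>.\<close>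

definition hdual :: "'n + 'n \<Rightarrow> 'n::finite heis \<Rightarrow> complex" where
  "hdual k p = (case k of Inl j \<Rightarrow> of_real (fst (snd p) $ j) | Inr j \<Rightarrow> - of_real (fst p $ j))"

definition hdir :: "'n + 'n \<Rightarrow> 'n::finite heis" where
  "hdir k = (case k of Inl j \<Rightarrow> (axis j 1, 0, 0) | Inr j \<Rightarrow> (0, axis j 1, 0))"

definition hfield :: "'n + 'n \<Rightarrow> ('n::finite heis \<Rightarrow> complex) \<Rightarrow> 'n heis \<Rightarrow> complex" where
  "hfield k f p = dir_deriv (hdir k) f p - hdual k p / 2 * vf_T f p"

definition horiz_sq :: "'n::finite heis \<Rightarrow> complex" where
  "horiz_sq p = of_real ((norm (horiz p))\<^sup>2)"

definition weight :: "('n::finite heis \<Rightarrow> complex) \<Rightarrow> 'n heis \<Rightarrow> complex" where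
  "weight f p = f p / horiz_sq p"

lemma sum_UNIV_Plus:
  "(\<Sum>k\<in>(UNIV :: ('n::finite + 'n) set). F k) = (\<Sum>j\<in>UNIV. F (Inl j) + F (Inr j))"
  by (simp add: UNIV_Plus_UNIV[symmetric] sum.Plus sum.distrib del: UNIV_Plus_UNIV)

lemma vf_T_dir_deriv: "vf_T f = dir_deriv (0, 0, 1) f"
  by (simp add: vf_T_def dir_deriv_def fun_eq_iff)

lemma hfield_Inl: "hfield (Inl j) f = vf_X j f"
  by (simp add: fun_eq_iff hfield_def vf_X_def d_x_def dir_deriv_def hdir_def hdual_def)

lemma hfield_Inr: "hfield (Inr j) f = vf_Y j f"
  by (simp add: fun_eq_iff hfield_def vf_Y_def d_y_def dir_deriv_def hdir_def hdual_def)

lemma sub_laplacian_hfield: "sub_laplacian f = (\<lambda>p. \<Sum>k\<in>UNIV. hfield k (hfield k f) p)"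
  by (simp add: fun_eq_iff sub_laplacian_def sum_UNIV_Plus hfield_Inl hfield_Inr)

lemma norm_hgrad_hfield: "(norm (hgrad f p))\<^sup>2 = (\<Sum>k\<in>UNIV. (norm (hfield k f p))\<^sup>2)"
  by (simp add: norm_hgrad_squared sum_UNIV_Plus hfield_Inl hfield_Inr)

lemma vf_Z_hdual: "vf_Z f = (\<lambda>p. - (\<Sum>k\<in>UNIV. hdual k p * dir_deriv (hdir k) f p))"
  by (simp add: fun_eq_iff vf_Z_def sum_UNIV_Plus hdual_def hdir_def d_x_def d_y_def dir_deriv_def
      sum_negf[symmetric])

lemma horiz_sq_hcoord: "horiz_sq p = (\<Sum>k\<in>UNIV. hcoord k p * hcoord k p)"
  by (simp add: horiz_sq_def norm_horiz sum_nonneg sum_UNIV_Plus hcoord_def power2_eq_square)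

lemma horiz_sq_hdual: "horiz_sq p = (\<Sum>k\<in>UNIV. hdual k p * hdual k p)"
  by (simp add: horiz_sq_def norm_horiz sum_nonneg sum_UNIV_Plus hdual_def power2_eq_square add.commute)

lemma sum_hcoord_hdual: "(\<Sum>k\<in>UNIV. hcoord k p * hdual k p) = 0"
  by (simp add: sum_UNIV_Plus hdual_def hcoord_def)

text \<open>The vertical parts cancel because \<open>hdual\<close> is orthogonal to \<open>hcoord\<close>; what remains is the Euler
  operator of the horizontal variables.\<close>

lemma horiz_dot_hgrad_euler: "horiz_dot_hgrad f = (\<lambda>p. \<Sum>k\<in>UNIV. hcoord k p * dir_deriv (hdir k) f p)"
proof
  fix p
  have "horiz_dot_hgrad f p = (\<Sum>k\<in>UNIV. hcoord k p * hfield k f p)"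
    by (simp add: horiz_dot_hgrad_def sum_UNIV_Plus hfield_Inl hfield_Inr hcoord_def)
  also have "\<dots> = (\<Sum>k\<in>UNIV. hcoord k p * dir_deriv (hdir k) f p)
      - (\<Sum>k\<in>UNIV. hcoord k p * hdual k p) * (vf_T f p / 2)"
    by (simp add: hfield_def right_diff_distrib sum_subtractf sum_distrib_right mult.assoc)
  finally show "horiz_dot_hgrad f p = (\<Sum>k\<in>UNIV. hcoord k p * dir_deriv (hdir k) f p)"
    by (simp add: sum_hcoord_hdual)
qed

lemma horiz_dot_hgrad_hfield: "horiz_dot_hgrad f = (\<lambda>p. \<Sum>k\<in>UNIV. hcoord k p * hfield k f p)"
  by (simp add: fun_eq_iff horiz_dot_hgrad_def sum_UNIV_Plus hfield_Inl hfield_Inr hcoord_def)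

lemma cnj_hcoord: "cnj (hcoord k p) = hcoord k p"
  by (simp add: hcoord_def split: sum.split)

lemma cnj_hdual: "cnj (hdual k p) = hdual k p"
  by (simp add: hdual_def split: sum.split)

lemma cnj_horiz_sq: "cnj (horiz_sq p) = horiz_sq p"
  by (simp add: horiz_sq_def)

lemma bounded_linear_hcoord: "bounded_linear (hcoord k)"
proof -
  have "linear (hcoord k)"
    by (rule linearI) (auto simp: hcoord_def scaleR_conv_of_real[where 'a = complex] split: sum.split)
  then show ?thesis by (rule linear_conv_bounded_linear[THEN iffD1])
qed

lemma bounded_linear_hdual: "bounded_linear (hdual k)"
proof -
  have "linear (hdual k)"
    by (rule linearI) (auto simp: hdual_def scaleR_conv_of_real[where 'a = complex] split: sum.split)
  then show ?thesis by (rule linear_conv_bounded_linear[THEN iffD1])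
qed

lemmas smooth_hcoord = smooth_bounded_linear[OF bounded_linear_hcoord]
lemmas smooth_hdual = smooth_bounded_linear[OF bounded_linear_hdual]

lemma hcoord_hdir: "hcoord k (hdir l) = (if k = l then 1 else 0)"
  by (auto simp: hcoord_def hdir_def axis_def split: sum.split)

lemma hcoord_vertical: "hcoord k (0, 0, t) = 0"
  by (simp add: hcoord_def split: sum.split)

lemma hdual_vertical: "hdual k (0, 0, t) = 0"
  by (simp add: hdual_def split: sum.split)

lemma hdual_Inl: "hdual (Inl j) p = hcoord (Inr j) p" and hdual_Inr: "hdual (Inr j) p = - hcoord (Inl j) p"
  by (simp_all add: hcoord_def hdual_def)

lemma sum_hcoord_hdual_hdir: "(\<Sum>l\<in>UNIV. hcoord l p * hdual k (hdir l)) = hdual k p"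
  by (cases k) (simp_all add: hdual_Inl hdual_Inr hcoord_hdir if_distrib sum_negf cong: if_cong)

lemma smooth_horiz_sq: "smooth horiz_sq"
proof -
  have "smooth (\<lambda>p. \<Sum>k\<in>UNIV. hcoord k p * hcoord k p)"
    by (intro smooth_sum smooth_mult smooth_hcoord)
  then show ?thesis by (simp add: horiz_sq_hcoord[abs_def])
qed

lemma dir_deriv_horiz_sq: "dir_deriv v horiz_sq = (\<lambda>p. \<Sum>k\<in>UNIV. 2 * hcoord k p * hcoord k v)"
proof -
  have "dir_deriv v horiz_sq = dir_deriv v (\<lambda>p. \<Sum>k\<in>UNIV. hcoord k p * hcoord k p)"
    by (simp add: horiz_sq_hcoord[abs_def])
  also have "\<dots> = (\<lambda>p. \<Sum>k\<in>UNIV. dir_deriv v (\<lambda>p. hcoord k p * hcoord k p) p)"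
    by (intro dir_deriv_sum smooth_differentiable smooth_mult smooth_hcoord)
  also have "\<dots> = (\<lambda>p. \<Sum>k\<in>UNIV. 2 * hcoord k p * hcoord k v)"
    by (simp add: dir_deriv_smooth_mult smooth_hcoord dir_deriv_bounded_linear bounded_linear_hcoord mult.commute mult.left_commute)
  finally show ?thesis .
qed

abbreviation heis_tests :: "('n::finite heis \<Rightarrow> complex) set" where
  "heis_tests \<equiv> test_functions {p. horiz p \<noteq> 0}"

lemmas L2_inner_sum_left_heis_tests = L2_inner_sum_left[where \<Omega> = "{p. horiz p \<noteq> 0}"]
lemmas L2_inner_sum_right_heis_tests = L2_inner_sum_right[where \<Omega> = "{p. horiz p \<noteq> 0}"]

lemma horiz_sq_nonzero: "p \<in> {p. horiz p \<noteq> 0} \<Longrightarrow> horiz_sq p \<noteq> 0"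
  by (simp add: horiz_sq_def)

lemma heis_tests_weight: "f \<in> heis_tests \<Longrightarrow> weight f \<in> heis_tests"
  unfolding weight_def[abs_def] by (rule test_functions_divide[OF smooth_horiz_sq horiz_sq_nonzero])

lemma heis_tests_T: "f \<in> heis_tests \<Longrightarrow> vf_T f \<in> heis_tests"
  by (simp add: vf_T_dir_deriv test_functions_dir_deriv)

lemma heis_tests_hcoord: "f \<in> heis_tests \<Longrightarrow> (\<lambda>p. hcoord k p * f p) \<in> heis_tests"
  by (rule test_functions_mult[OF smooth_hcoord])

lemma heis_tests_hdual: "f \<in> heis_tests \<Longrightarrow> (\<lambda>p. hdual k p * f p) \<in> heis_tests"
  by (rule test_functions_mult[OF smooth_hdual])

lemma hfield_eq: "hfield k f = (\<lambda>p. dir_deriv (hdir k) f p - (1/2) * (hdual k p * vf_T f p))"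
  by (simp add: hfield_def fun_eq_iff)

lemma heis_tests_hfield: "f \<in> heis_tests \<Longrightarrow> hfield k f \<in> heis_tests"
  unfolding hfield_eq
  by (intro test_functions_diff test_functions_smult heis_tests_hdual heis_tests_T test_functions_dir_deriv)

lemma heis_tests_euler: "f \<in> heis_tests \<Longrightarrow> horiz_dot_hgrad f \<in> heis_tests"
  unfolding horiz_dot_hgrad_euler by (intro test_functions_sum heis_tests_hcoord test_functions_dir_deriv)

lemma heis_tests_sub_laplacian: "f \<in> heis_tests \<Longrightarrow> sub_laplacian f \<in> heis_tests"
  unfolding sub_laplacian_hfield by (intro test_functions_sum heis_tests_hfield)

lemma heis_tests_Z:
  assumes "f \<in> heis_tests" shows "vf_Z f \<in> heis_tests"
proof -
  have "(\<lambda>p. (-1) * (\<Sum>k\<in>UNIV. hdual k p * dir_deriv (hdir k) f p)) \<in> heis_tests"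
    by (intro test_functions_smult test_functions_sum heis_tests_hdual test_functions_dir_deriv assms)
  then show ?thesis by (simp add: vf_Z_hdual)
qed

lemmas heis_tests_intros = heis_tests_weight heis_tests_T heis_tests_hcoord heis_tests_hdual
  heis_tests_hfield heis_tests_euler heis_tests_sub_laplacian heis_tests_Z
  test_functions_dir_deriv

section \<open>Skew-adjointness and commutation relations\<close>

lemma dir_deriv_hcoord_mult:
  "f \<in> heis_tests \<Longrightarrow> dir_deriv v (\<lambda>p. hcoord k p * f p) = (\<lambda>p. hcoord k p * dir_deriv v f p + hcoord k v * f p)"
  by (simp add: dir_deriv_smooth_mult smooth_hcoord test_functionsD(1) dir_deriv_bounded_linear bounded_linear_hcoord)

lemma dir_deriv_hdual_mult:
  "f \<in> heis_tests \<Longrightarrow> dir_deriv v (\<lambda>p. hdual k p * f p) = (\<lambda>p. hdual k p * dir_deriv v f p + hdual k v * f p)"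
  by (simp add: dir_deriv_smooth_mult smooth_hdual test_functionsD(1) dir_deriv_bounded_linear bounded_linear_hdual)

lemma vf_T_hdual_mult: "f \<in> heis_tests \<Longrightarrow> vf_T (\<lambda>p. hdual k p * f p) = (\<lambda>p. hdual k p * vf_T f p)"
  by (simp add: vf_T_dir_deriv dir_deriv_hdual_mult hdual_vertical)

lemma L2_inner_vf_T: "g \<in> heis_tests \<Longrightarrow> h \<in> heis_tests \<Longrightarrow> L2_inner (vf_T g) h = - L2_inner g (vf_T h)"
  by (simp add: vf_T_dir_deriv L2_inner_dir_deriv)

lemma L2_inner_hdual: "L2_inner (\<lambda>p. hdual k p * g p) h = L2_inner g (\<lambda>p. hdual k p * h p)"
  by (rule L2_inner_move[OF cnj_hdual])

lemma L2_inner_hcoord: "L2_inner (\<lambda>p. hcoord k p * g p) h = L2_inner g (\<lambda>p. hcoord k p * h p)"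
  by (rule L2_inner_move[OF cnj_hcoord])

lemma L2_inner_weight: "L2_inner (weight g) h = L2_inner g (weight h)"
  by (simp add: L2_inner_def weight_def cnj_horiz_sq)

text \<open>The coefficient of \<open>T\<close> in a horizontal field does not depend on the vertical variable, so the
  field is skew-adjoint like its two parts.\<close>

lemma L2_inner_hfield:
  assumes g: "g \<in> heis_tests" and h: "h \<in> heis_tests"
  shows "L2_inner (hfield k g) h = - L2_inner g (hfield k h)"
proof -
  have "L2_inner (hfield k g) h = L2_inner (dir_deriv (hdir k) g) h - (1/2) * L2_inner (vf_T g) (\<lambda>p. hdual k p * h p)"
    unfolding hfield_eq
    by (subst L2_inner_diff_left[where \<Omega> = "{p. horiz p \<noteq> 0}"])
       (intro heis_tests_intros test_functions_smult g h | simp only: L2_inner_const_left L2_inner_hdual)+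
  also have "\<dots> = - (L2_inner g (dir_deriv (hdir k) h) - (1/2) * L2_inner g (\<lambda>p. hdual k p * vf_T h p))"
    by (simp add: L2_inner_dir_deriv[OF g h] L2_inner_vf_T[OF g heis_tests_hdual[OF h]] vf_T_hdual_mult[OF h])
  also have "L2_inner g (dir_deriv (hdir k) h) - (1/2) * L2_inner g (\<lambda>p. hdual k p * vf_T h p) = L2_inner g (hfield k h)"
    unfolding hfield_eq
    by (subst L2_inner_diff_right[where \<Omega> = "{p. horiz p \<noteq> 0}"])
       (intro heis_tests_intros test_functions_smult g h | simp add: L2_inner_const_right[of g "1/2", simplified])+
  finally show ?thesis .
qed

lemma sum_hcoord_delta: "(\<Sum>l\<in>UNIV. F l * hcoord l (hdir k)) = F k"
  by (simp add: hcoord_hdir if_distrib cong: if_cong)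

lemma dir_deriv_weight:
  "f \<in> heis_tests \<Longrightarrow> dir_deriv v (weight f) = (\<lambda>p. weight (dir_deriv v f) p - dir_deriv v horiz_sq p * weight (weight f) p)"
  unfolding weight_def[abs_def]
  by (subst dir_deriv_divide_test_function[OF _ smooth_horiz_sq horiz_sq_nonzero])
     (auto simp: power2_eq_square)

lemma dir_deriv_hdir_horiz_sq: "dir_deriv (hdir k) horiz_sq p = 2 * hcoord k p"
  by (simp add: dir_deriv_horiz_sq sum_hcoord_delta)

lemma vf_T_weight: "f \<in> heis_tests \<Longrightarrow> vf_T (weight f) = weight (vf_T f)"
  by (simp add: vf_T_dir_deriv dir_deriv_weight dir_deriv_horiz_sq hcoord_vertical)

lemma hfield_weight:
  "f \<in> heis_tests \<Longrightarrow> hfield k (weight f) = (\<lambda>p. weight (hfield k f) p - 2 * (hcoord k p * weight (weight f) p))"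
  by (simp add: fun_eq_iff hfield_def vf_T_weight dir_deriv_weight dir_deriv_hdir_horiz_sq)
     (simp add: weight_def hfield_def diff_divide_distrib)

lemma weight_diff: "weight (\<lambda>p. f p - g p) = (\<lambda>p. weight f p - weight g p)"
  by (simp add: weight_def fun_eq_iff diff_divide_distrib)

lemma weight_add: "weight (\<lambda>p. f p + g p) = (\<lambda>p. weight f p + weight g p)"
  by (simp add: weight_def fun_eq_iff add_divide_distrib)

lemma weight_const: "weight (\<lambda>p. c * f p) = (\<lambda>p. c * weight f p)"
  by (simp add: weight_def fun_eq_iff)

text \<open>The squared radius is homogeneous of degree two under horizontal dilations.\<close>

lemma euler_weight:
  assumes f: "f \<in> heis_tests"
  shows "horiz_dot_hgrad (weight f) = (\<lambda>p. weight (horiz_dot_hgrad f) p - 2 * weight f p)"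
proof
  fix p
  have "horiz_dot_hgrad (weight f) p
     = (\<Sum>k\<in>UNIV. hcoord k p * weight (dir_deriv (hdir k) f) p) - 2 * (\<Sum>k\<in>UNIV. hcoord k p * hcoord k p) * weight (weight f) p"
    by (simp add: horiz_dot_hgrad_euler dir_deriv_weight[OF f] dir_deriv_hdir_horiz_sq right_diff_distrib
        sum_subtractf sum_distrib_left sum_distrib_right mult.assoc mult.left_commute)
  also have "\<dots> = weight (horiz_dot_hgrad f) p - 2 * weight f p"
    by (simp add: horiz_sq_hcoord[symmetric]) (simp add: weight_def horiz_dot_hgrad_euler sum_divide_distrib)
  finally show "horiz_dot_hgrad (weight f) p = weight (horiz_dot_hgrad f) p - 2 * weight f p" .
qed

text \<open>The divergence of the Euler field is the number of horizontal variables.\<close>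

lemma L2_inner_euler:
  fixes g h :: "'n::finite heis \<Rightarrow> complex"
  assumes g: "g \<in> heis_tests" and h: "h \<in> heis_tests"
  shows "L2_inner (horiz_dot_hgrad g) h = - of_nat (2 * CARD('n)) * L2_inner g h - L2_inner g (horiz_dot_hgrad h)"
proof -
  have "L2_inner (horiz_dot_hgrad g) h = (\<Sum>k\<in>UNIV. L2_inner (\<lambda>p. hcoord k p * dir_deriv (hdir k) g p) h)"
    unfolding horiz_dot_hgrad_euler by (intro L2_inner_sum_left_heis_tests heis_tests_intros g h)
  also have "\<dots> = (\<Sum>k\<in>UNIV. - L2_inner g (\<lambda>p. hcoord k p * dir_deriv (hdir k) h p) - L2_inner g h)"
  proof (intro sum.cong refl)
    fix k :: "'n + 'n"
    have "L2_inner (\<lambda>p. hcoord k p * dir_deriv (hdir k) g p) h = - L2_inner g (dir_deriv (hdir k) (\<lambda>p. hcoord k p * h p))"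
      unfolding L2_inner_hcoord by (rule L2_inner_dir_deriv[OF g heis_tests_hcoord[OF h]])
    also have "\<dots> = - L2_inner g (\<lambda>p. hcoord k p * dir_deriv (hdir k) h p + h p)"
      by (simp add: dir_deriv_hcoord_mult[OF h] hcoord_hdir)
    also have "\<dots> = - L2_inner g (\<lambda>p. hcoord k p * dir_deriv (hdir k) h p) - L2_inner g h"
      by (subst L2_inner_add_right[where \<Omega> = "{p. horiz p \<noteq> 0}"]) (intro heis_tests_intros g h | simp)+
    finally show "L2_inner (\<lambda>p. hcoord k p * dir_deriv (hdir k) g p) h
      = - L2_inner g (\<lambda>p. hcoord k p * dir_deriv (hdir k) h p) - L2_inner g h" .
  qed
  also have "\<dots> = - (\<Sum>k\<in>UNIV. L2_inner g (\<lambda>p. hcoord k p * dir_deriv (hdir k) h p)) - of_nat (2 * CARD('n)) * L2_inner g h"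
    by (simp add: sum_subtractf sum_negf card_Plus UNIV_Plus_UNIV[symmetric] del: UNIV_Plus_UNIV)
  also have "(\<Sum>k\<in>UNIV. L2_inner g (\<lambda>p. hcoord k p * dir_deriv (hdir k) h p)) = L2_inner g (horiz_dot_hgrad h)"
    unfolding horiz_dot_hgrad_euler by (intro L2_inner_sum_right_heis_tests[symmetric] heis_tests_intros g h)
  finally show ?thesis by simp
qed

lemma heis_tests_weight_pow: "f \<in> heis_tests \<Longrightarrow> (weight ^^ m) f \<in> heis_tests"
  by (induction m) (auto intro: heis_tests_weight)

lemma weight_pow_2: "(weight ^^ 2) f = weight (weight f)"
  by (simp add: numeral_2_eq_2)

lemma L2_inner_weight_pow: "L2_inner ((weight ^^ m) g) h = L2_inner g ((weight ^^ m) h)"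
proof (induction m arbitrary: h)
  case (Suc m)
  have "weight ((weight ^^ m) h) = (weight ^^ m) (weight h)"
    by (rule funpow_swap1)
  then show ?case by (simp add: L2_inner_weight Suc.IH)
qed simp

lemma euler_weight_pow:
  assumes f: "f \<in> heis_tests"
  shows "horiz_dot_hgrad ((weight ^^ m) f)
    = (\<lambda>p. (weight ^^ m) (horiz_dot_hgrad f) p - 2 * of_nat m * (weight ^^ m) f p)"
proof (induction m)
  case (Suc m)
  have "horiz_dot_hgrad ((weight ^^ Suc m) f)
     = (\<lambda>p. weight (horiz_dot_hgrad ((weight ^^ m) f)) p - 2 * (weight ^^ Suc m) f p)"
    by (simp add: euler_weight heis_tests_weight_pow f)
  then show ?case
    unfolding Suc.IH weight_diff weight_const by (simp add: algebra_simps)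
qed simp

text \<open>The weight commutes with the Euler operator up to a multiple of itself, so integration by parts
  returns the conjugate of the same inner product, and only the scalar terms survive in the real part.\<close>

lemma Re_L2_inner_euler_weight_pow:
  fixes u :: "'n::finite heis \<Rightarrow> complex"
  assumes u: "u \<in> heis_tests"
  shows "2 * Re (L2_inner (horiz_dot_hgrad u) ((weight ^^ m) u))
    = (2 * real m - 2 * real CARD('n)) * Re (L2_inner u ((weight ^^ m) u))"
proof -
  let ?v = "(weight ^^ m) u" and ?c = "2 * of_nat m :: complex"
  have "L2_inner (horiz_dot_hgrad u) ?v = - of_nat (2 * CARD('n)) * L2_inner u ?v - L2_inner u (horiz_dot_hgrad ?v)"
    by (intro L2_inner_euler heis_tests_weight_pow u)
  also have "L2_inner u (horiz_dot_hgrad ?v) = L2_inner u ((weight ^^ m) (horiz_dot_hgrad u)) - ?c * L2_inner u ?v"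
    unfolding euler_weight_pow[OF u]
    by (subst L2_inner_diff_right[where \<Omega> = "{p. horiz p \<noteq> 0}"])
       (intro heis_tests_weight_pow heis_tests_euler u test_functions_smult | simp add: L2_inner_const_right)+
  also have "L2_inner u ((weight ^^ m) (horiz_dot_hgrad u)) = cnj (L2_inner (horiz_dot_hgrad u) ?v)"
    by (simp add: cnj_L2_inner L2_inner_weight_pow)
  finally have "Re (L2_inner (horiz_dot_hgrad u) ?v)
     = Re (- of_nat (2 * CARD('n)) * L2_inner u ?v - (cnj (L2_inner (horiz_dot_hgrad u) ?v) - ?c * L2_inner u ?v))"
    by (rule arg_cong)
  then show ?thesis by (simp add: algebra_simps)
qed

text \<open>Each horizontal field is moved to the right-hand factor; where it hits the weight it produces a
  horizontal coordinate, and these coordinates reassemble the Euler operator.\<close>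

lemma L2_inner_sub_laplacian_weight:
  assumes f: "f \<in> heis_tests" and g: "g \<in> heis_tests"
  shows "L2_inner (sub_laplacian f) (weight g)
    = - (\<Sum>k\<in>UNIV. L2_inner (hfield k f) (weight (hfield k g))) + 2 * L2_inner (horiz_dot_hgrad f) (weight (weight g))"
proof -
  have "L2_inner (sub_laplacian f) (weight g) = (\<Sum>k\<in>UNIV. L2_inner (hfield k (hfield k f)) (weight g))"
    unfolding sub_laplacian_hfield by (intro L2_inner_sum_left_heis_tests heis_tests_intros f g)
  also have "\<dots> = (\<Sum>k\<in>UNIV. - L2_inner (hfield k f) (weight (hfield k g)) + 2 * L2_inner (\<lambda>p. hcoord k p * hfield k f p) (weight (weight g)))"
  proof (intro sum.cong refl)
    fix k :: "'a + 'a"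
    have "L2_inner (hfield k (hfield k f)) (weight g) = - L2_inner (hfield k f) (hfield k (weight g))"
      by (intro L2_inner_hfield heis_tests_intros f g)
    also have "L2_inner (hfield k f) (hfield k (weight g))
       = L2_inner (hfield k f) (weight (hfield k g)) - 2 * L2_inner (hfield k f) (\<lambda>p. hcoord k p * weight (weight g) p)"
      unfolding hfield_weight[OF g]
      by (subst L2_inner_diff_right[where \<Omega> = "{p. horiz p \<noteq> 0}"])
         (intro heis_tests_intros f g test_functions_smult | simp add: L2_inner_const_right)+
    finally show "L2_inner (hfield k (hfield k f)) (weight g)
       = - L2_inner (hfield k f) (weight (hfield k g)) + 2 * L2_inner (\<lambda>p. hcoord k p * hfield k f p) (weight (weight g))"
      by (simp add: L2_inner_hcoord)
  qed
  also have "\<dots> = - (\<Sum>k\<in>UNIV. L2_inner (hfield k f) (weight (hfield k g)))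
      + 2 * (\<Sum>k\<in>UNIV. L2_inner (\<lambda>p. hcoord k p * hfield k f p) (weight (weight g)))"
    by (simp add: sum.distrib sum_subtractf sum_negf sum_distrib_left)
  also have "(\<Sum>k\<in>UNIV. L2_inner (\<lambda>p. hcoord k p * hfield k f p) (weight (weight g))) = L2_inner (horiz_dot_hgrad f) (weight (weight g))"
    unfolding horiz_dot_hgrad_hfield by (intro L2_inner_sum_left_heis_tests[symmetric] heis_tests_intros f g)
  finally show ?thesis .
qed

text \<open>If the dilations generated by the Euler operator also scaled the vertical variable (quadratically),
  the commutator would be the field itself. They leave it fixed, which adds the coefficient of \<open>T\<close>
  to the commutator. This defect is the source of the terms in \<open>Z T\<close> and \<open>T\<close>.\<close>

lemma hfield_euler:
  fixes f :: "'n::finite heis \<Rightarrow> complex"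
  assumes f: "f \<in> heis_tests"
  shows "hfield k (horiz_dot_hgrad f)
    = (\<lambda>p. horiz_dot_hgrad (hfield k f) p + hfield k f p + hdual k p * vf_T f p)"
proof
  fix p
  have sm: "smooth (\<lambda>p. hcoord l p * dir_deriv (hdir l) f p)" for l
    by (rule test_functionsD(1)[of _ "{p. horiz p \<noteq> 0}"]) (intro heis_tests_intros f)
  have D: "dir_deriv v (horiz_dot_hgrad f) p
     = (\<Sum>l\<in>UNIV. hcoord l p * dir_deriv (hdir l) (dir_deriv v f) p) + (\<Sum>l\<in>UNIV. dir_deriv (hdir l) f p * hcoord l v)" for v
    unfolding horiz_dot_hgrad_euler
    by (simp add: dir_deriv_sum smooth_differentiable[OF sm] dir_deriv_hcoord_mult test_functions_dir_deriv f
        sum.distrib mult.commute dir_deriv_commute[of f v] test_functionsD(1)[OF f])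
  have T: "vf_T (horiz_dot_hgrad f) p = (\<Sum>l\<in>UNIV. hcoord l p * dir_deriv (hdir l) (vf_T f) p)"
    by (simp add: vf_T_dir_deriv D hcoord_vertical)
  have H: "dir_deriv v (hfield k f) p = dir_deriv v (dir_deriv (hdir k) f) p
     - (1/2) * (hdual k p * dir_deriv v (vf_T f) p + hdual k v * vf_T f p)" for v
  proof -
    have "smooth (dir_deriv (hdir k) f)" "smooth (\<lambda>p. hdual k p * vf_T f p)"
      by (rule test_functionsD(1)[of _ "{p. horiz p \<noteq> 0}"], intro heis_tests_intros f)+
    then show ?thesis
      unfolding hfield_eq by (simp only: dir_deriv_diff_smult dir_deriv_hdual_mult[OF heis_tests_T[OF f]])
  qed
  have "horiz_dot_hgrad (hfield k f) p
     = (\<Sum>l\<in>UNIV. hcoord l p * dir_deriv (hdir l) (dir_deriv (hdir k) f) p)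
       - (hdual k p / 2) * (\<Sum>l\<in>UNIV. hcoord l p * dir_deriv (hdir l) (vf_T f) p)
       - (\<Sum>l\<in>UNIV. hcoord l p * hdual k (hdir l)) * vf_T f p / 2"
    unfolding horiz_dot_hgrad_euler H
    by (simp add: sum_subtractf sum.distrib sum_distrib_left sum_distrib_right sum_divide_distrib algebra_simps)
  then show "hfield k (horiz_dot_hgrad f) p
     = horiz_dot_hgrad (hfield k f) p + hfield k f p + hdual k p * vf_T f p"
    unfolding hfield_def[of k "horiz_dot_hgrad f"] D T sum_hcoord_delta sum_hcoord_hdual_hdir
    by (simp add: hfield_def)
qed

lemma vf_T_vf_Z:
  assumes f: "f \<in> heis_tests"
  shows "vf_T (vf_Z f) = vf_Z (vf_T f)"
proof -
  have sm: "smooth (\<lambda>p. hdual l p * dir_deriv (hdir l) f p)" for l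
    by (rule test_functionsD(1)[of _ "{p. horiz p \<noteq> 0}"]) (intro heis_tests_intros f)
  have "vf_T (vf_Z f) = dir_deriv (0,0,1) (\<lambda>p. 0 - 1 * (\<Sum>k\<in>UNIV. hdual k p * dir_deriv (hdir k) f p))"
    by (simp add: vf_T_dir_deriv vf_Z_hdual)
  also have "\<dots> = (\<lambda>p. - dir_deriv (0,0,1) (\<lambda>p. \<Sum>k\<in>UNIV. hdual k p * dir_deriv (hdir k) f p) p)"
    by (subst dir_deriv_diff_smult[OF smooth_const smooth_sum[OF sm]]) (simp add: dir_deriv_const)
  also have "\<dots> = vf_Z (vf_T f)"
    by (simp add: dir_deriv_sum smooth_differentiable[OF sm] dir_deriv_hdual_mult test_functions_dir_deriv f
        hdual_vertical vf_Z_hdual vf_T_dir_deriv dir_deriv_commute[of f "(0,0,1)"] test_functionsD(1)[OF f])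
  finally show ?thesis .
qed

lemma sum_hdual_hfield:
  "(\<Sum>k\<in>UNIV. hdual k p * hfield k f p) = - vf_Z f p - 1/2 * (horiz_sq p * vf_T f p)"
  by (simp add: hfield_def horiz_sq_hdual vf_Z_hdual right_diff_distrib sum_subtractf sum_distrib_right
      sum_distrib_left sum_divide_distrib mult.assoc)

lemma L2_inner_ZT: "L2_inner (vf_Z (vf_T f)) (weight f) = ZT_integral f"
  by (simp add: L2_inner_def ZT_integral_def weight_def horiz_sq_def mult.commute)

lemma heis_tests_zero_on_axis: "f \<in> heis_tests \<Longrightarrow> horiz_sq p = 0 \<Longrightarrow> f p = 0"
  using test_functionsD(3)[of f "{p. horiz p \<noteq> 0}"] in_support[of f p] by (auto simp: horiz_sq_def)

text \<open>The defect in \<open>hfield_euler\<close> is paired with the horizontal gradient: the contraction of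
  \<open>hdual\<close> with the fields is \<open>- Z - |x|^2 T / 2\<close>, with \<open>|x|\<close> the horizontal radius. The weight cancels \<open>|x|^2\<close>, and \<open>T\<close>
  moves across to give the integral of \<open>Z T f\<close>.\<close>

lemma sum_L2_inner_hfield_hdual:
  assumes f: "f \<in> heis_tests"
  shows "(\<Sum>k\<in>UNIV. L2_inner (hfield k f) (weight (\<lambda>p. hdual k p * vf_T f p)))
    = ZT_integral f - 1/2 * L2_inner (vf_T f) (vf_T f)"
proof -
  have qT: "(\<lambda>p. horiz_sq p * vf_T f p) \<in> heis_tests"
    by (rule test_functions_mult[OF smooth_horiz_sq heis_tests_T[OF f]])
  have mZ: "(\<lambda>p. -1 * vf_Z f p) \<in> heis_tests" by (intro test_functions_smult heis_tests_intros f)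
  have "L2_inner (hfield k f) (weight (\<lambda>p. hdual k p * vf_T f p)) = L2_inner (\<lambda>p. hdual k p * hfield k f p) (weight (vf_T f))" for k
    unfolding L2_inner_hdual by (simp add: weight_def[abs_def])
  then have "(\<Sum>k\<in>UNIV. L2_inner (hfield k f) (weight (\<lambda>p. hdual k p * vf_T f p)))
      = (\<Sum>k\<in>UNIV. L2_inner (\<lambda>p. hdual k p * hfield k f p) (weight (vf_T f)))" by simp
  also have "\<dots> = L2_inner (\<lambda>p. \<Sum>k\<in>UNIV. hdual k p * hfield k f p) (weight (vf_T f))"
    by (intro L2_inner_sum_left_heis_tests[symmetric] heis_tests_intros f)
  also have "\<dots> = L2_inner (\<lambda>p. -1 * vf_Z f p - 1/2 * (horiz_sq p * vf_T f p)) (weight (vf_T f))"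
    by (simp add: sum_hdual_hfield)
  also have "\<dots> = - L2_inner (vf_Z f) (weight (vf_T f)) - 1/2 * L2_inner (\<lambda>p. horiz_sq p * vf_T f p) (weight (vf_T f))"
    by (subst L2_inner_diff_left[OF mZ test_functions_smult[OF qT] heis_tests_weight[OF heis_tests_T[OF f]]])
       (simp only: L2_inner_const_left, simp)
  also have "L2_inner (\<lambda>p. horiz_sq p * vf_T f p) (weight (vf_T f)) = L2_inner (vf_T f) (vf_T f)"
  proof -
    have "horiz_sq p * vf_T f p * cnj (vf_T f p / horiz_sq p) = vf_T f p * cnj (vf_T f p)" for p
      using heis_tests_zero_on_axis[OF heis_tests_T[OF f], of p] by (cases "horiz_sq p = 0") (auto simp: cnj_horiz_sq)
    then show ?thesis by (simp add: L2_inner_def weight_def)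
  qed
  also have "L2_inner (vf_Z f) (weight (vf_T f)) = - L2_inner (vf_T (vf_Z f)) (weight f)"
    by (simp add: L2_inner_vf_T[OF heis_tests_Z[OF f] heis_tests_weight[OF f]] vf_T_weight[OF f])
  finally show ?thesis by (simp add: vf_T_vf_Z[OF f] L2_inner_ZT)
qed

section \<open>Norm identities and the inequalities\<close>

lemma L2_norm_squared: "(L2_norm g)\<^sup>2 = (LINT p|lborel. (norm (g p))\<^sup>2)"
  by (simp add: L2_norm_def)

lemma L2_norm_squared_L2_inner: "(L2_norm g)\<^sup>2 = Re (L2_inner g g)"
  by (simp add: L2_norm_squared L2_inner_self)

lemma Re_L2_inner_square_nonneg:
  fixes a b :: real
  assumes u: "u \<in> test_functions \<Omega>" and v: "v \<in> test_functions \<Omega>" and z: "z \<in> test_functions \<Omega>"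
  shows "0 \<le> Re (L2_inner u u) + a\<^sup>2 * Re (L2_inner v v) + b\<^sup>2 * Re (L2_inner z z)
    + 2 * a * Re (L2_inner u v) + 2 * b * Re (L2_inner u z) + 2 * a * b * Re (L2_inner v z)"
proof -
  let ?v = "\<lambda>p. of_real a * v p" and ?z = "\<lambda>p. of_real b * z p"
  let ?s = "\<lambda>p. ?v p + ?z p" and ?w = "\<lambda>p. u p + (of_real a * v p + of_real b * z p)"
  note t = u test_functions_smult[OF v, of "of_real a"] test_functions_smult[OF z, of "of_real b"]
  note ts = test_functions_add[OF t(2,3)]
  have "0 \<le> Re (L2_inner ?w ?w)"
    unfolding L2_norm_squared_L2_inner[symmetric] by simp
  also have "L2_inner ?w ?w = L2_inner u u + L2_inner u ?v + L2_inner u ?z + L2_inner ?v u + L2_inner ?v ?v + L2_inner ?v ?z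
      + L2_inner ?z u + L2_inner ?z ?v + L2_inner ?z ?z"
    by (simp add: L2_inner_add_left[OF t(1) ts test_functions_add[OF t(1) ts]]
        L2_inner_add_left[OF t(2,3) test_functions_add[OF t(1) ts]] L2_inner_add_right[OF t(1) ts]
        L2_inner_add_right[OF t(2,3)] t)
  finally show ?thesis
    using Re_L2_inner_commute[of v u] Re_L2_inner_commute[of z u] Re_L2_inner_commute[of z v]
    by (simp add: L2_inner_const_left L2_inner_const_right power2_eq_square algebra_simps)
qed

lemma Re_L2_inner_eq_integral:
  assumes "g \<in> test_functions \<Omega>" "h \<in> test_functions \<Omega>"
  shows "integrable lborel (\<lambda>p. Re (g p * cnj (h p)))"
    and "Re (L2_inner g h) = (LINT p|lborel. Re (g p * cnj (h p)))"
  using integrable_mult_cnj[OF assms] by (simp_all add: L2_inner_def del: Re_complex_of_real times_complex.sel)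

lemma Re_mult_cnj_weight: "Re (u p * cnj (weight u p)) = (norm (u p))\<^sup>2 / (norm (horiz p))\<^sup>2"
proof -
  have "u p * cnj (weight u p) = of_real ((norm (u p))\<^sup>2 / (norm (horiz p))\<^sup>2)"
    using complex_norm_square[of "u p"] by (simp add: weight_def horiz_sq_def)
  then show ?thesis by simp
qed

lemma hgrad_weighted_integrand:
  "(norm (hgrad f p /\<^sub>R norm (horiz p)))\<^sup>2 = (\<Sum>k\<in>UNIV. Re (hfield k f p * cnj (weight (hfield k f) p)))"
  unfolding Re_mult_cnj_weight sum_divide_distrib[symmetric] norm_hgrad_hfield[symmetric]
  by (simp add: power_mult_distrib power_inverse divide_inverse)

lemma hgrad_weighted_norm:
  assumes "f \<in> heis_tests"
  shows "(L2_norm (\<lambda>p. hgrad f p /\<^sub>R norm (horiz p)))\<^sup>2 = (\<Sum>k\<in>UNIV. Re (L2_inner (hfield k f) (weight (hfield k f))))"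
    and "integrable lborel (\<lambda>p. (norm (hgrad f p /\<^sub>R norm (horiz p)))\<^sup>2)"
proof -
  note i = Re_L2_inner_eq_integral[OF heis_tests_hfield[OF assms] heis_tests_weight[OF heis_tests_hfield[OF assms]]]
  show "(L2_norm (\<lambda>p. hgrad f p /\<^sub>R norm (horiz p)))\<^sup>2 = (\<Sum>k\<in>UNIV. Re (L2_inner (hfield k f) (weight (hfield k f))))"
    unfolding L2_norm_squared hgrad_weighted_integrand i(2)
    by (rule Bochner_Integration.integral_sum) (rule i(1))
  show "integrable lborel (\<lambda>p. (norm (hgrad f p /\<^sub>R norm (horiz p)))\<^sup>2)"
    unfolding hgrad_weighted_integrand by (intro Bochner_Integration.integrable_sum i(1))
qed

lemma weight_scaleR: "(\<lambda>p. g p /\<^sub>R (norm (horiz p))\<^sup>2) = weight g"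
  by (simp add: fun_eq_iff weight_def horiz_sq_def scaleR_conv_of_real divide_inverse mult.commute)

lemma norm_hcoord_sum: "(norm (horiz p))\<^sup>2 = (\<Sum>k\<in>UNIV. (norm (hcoord k p))\<^sup>2)"
  by (simp add: norm_horiz sum_nonneg sum_UNIV_Plus hcoord_def)

text \<open>This is the Cauchy-Schwarz inequality in the horizontal variables.\<close>

lemma norm_euler_le: "(norm (horiz_dot_hgrad f p))\<^sup>2 \<le> (norm (horiz p))\<^sup>2 * (norm (hgrad f p))\<^sup>2"
proof -
  have "norm (horiz_dot_hgrad f p) \<le> (\<Sum>k\<in>UNIV. \<bar>norm (hcoord k p)\<bar> * \<bar>norm (hfield k f p)\<bar>)"
    unfolding horiz_dot_hgrad_hfield by (rule order_trans[OF norm_sum]) (simp add: norm_mult)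
  also have "\<dots> \<le> L2_set (\<lambda>k. norm (hcoord k p)) UNIV * L2_set (\<lambda>k. norm (hfield k f p)) UNIV"
    by (rule L2_set_mult_ineq)
  also have "\<dots> = norm (horiz p) * norm (hgrad f p)"
    by (simp add: L2_set_def norm_hcoord_sum[symmetric] norm_hgrad_hfield[symmetric])
  finally show ?thesis
    unfolding power_mult_distrib[symmetric] by (rule power_mono) simp
qed

lemma euler_le_hgrad:
  assumes f: "f \<in> heis_tests"
  shows "(L2_norm (\<lambda>p. horiz_dot_hgrad f p /\<^sub>R (norm (horiz p))\<^sup>2))\<^sup>2
    \<le> (L2_norm (\<lambda>p. hgrad f p /\<^sub>R norm (horiz p)))\<^sup>2"
  unfolding L2_norm_squared
proof (rule integral_mono)
  have "integrable lborel (\<lambda>p. Re (weight (horiz_dot_hgrad f) p * cnj (weight (horiz_dot_hgrad f) p)))"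
    by (rule Re_L2_inner_eq_integral(1)[where \<Omega> = "{p. horiz p \<noteq> 0}"]) (intro heis_tests_intros f)+
  then show "integrable lborel (\<lambda>p. (norm (horiz_dot_hgrad f p /\<^sub>R (norm (horiz p))\<^sup>2))\<^sup>2)"
    unfolding weight_scaleR[THEN fun_cong] complex_norm_square[symmetric] Re_complex_of_real .
  show "integrable lborel (\<lambda>p. (norm (hgrad f p /\<^sub>R norm (horiz p)))\<^sup>2)"
    by (rule hgrad_weighted_norm(2)[OF f])
  fix p
  show "(norm (horiz_dot_hgrad f p /\<^sub>R (norm (horiz p))\<^sup>2))\<^sup>2 \<le> (norm (hgrad f p /\<^sub>R norm (horiz p)))\<^sup>2"
  proof (cases "norm (horiz p) = 0")
    case False
    then show ?thesis
      using norm_euler_le[of f p] by (simp add: power_mult_distrib field_simps power2_eq_square)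
  qed simp
qed

lemma Re_L2_inner_sub_laplacian_weighted:
  fixes f :: "'n::finite heis \<Rightarrow> complex"
  assumes f: "f \<in> heis_tests" and N: "N = 2 * real CARD('n)"
  shows "Re (L2_inner (sub_laplacian f) (weight f))
    = - (L2_norm (\<lambda>p. hgrad f p /\<^sub>R norm (horiz p)))\<^sup>2 - (N - 4) * (L2_norm (weight f))\<^sup>2"
proof -
  have "L2_inner (sub_laplacian f) (weight f)
    = - (\<Sum>k\<in>UNIV. L2_inner (hfield k f) (weight (hfield k f))) + 2 * L2_inner (horiz_dot_hgrad f) (weight (weight f))"
    by (rule L2_inner_sub_laplacian_weight[OF f f])
  from arg_cong[OF this, of Re] show ?thesis
    using Re_L2_inner_euler_weight_pow[OF f, of 2]
    by (simp add: hgrad_weighted_norm(1)[OF f] L2_norm_squared_L2_inner L2_inner_weight weight_pow_2 N algebra_simps)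
qed

lemma Re_L2_inner_sub_laplacian_euler:
  fixes f :: "'n::finite heis \<Rightarrow> complex"
  assumes f: "f \<in> heis_tests" and N: "N = 2 * real CARD('n)"
  shows "Re (L2_inner (sub_laplacian f) (weight (horiz_dot_hgrad f)))
    = 2 * (L2_norm (weight (horiz_dot_hgrad f)))\<^sup>2
      + (N / 2 - 2) * (L2_norm (\<lambda>p. hgrad f p /\<^sub>R norm (horiz p)))\<^sup>2
      - Re (ZT_integral f) + 1/2 * (L2_norm (vf_T f))\<^sup>2"
proof -
  let ?E = "horiz_dot_hgrad :: ('n heis \<Rightarrow> complex) \<Rightarrow> 'n heis \<Rightarrow> complex"
  have term_k: "L2_inner (hfield k f) (weight (hfield k (?E f)))
     = L2_inner (hfield k f) (weight (?E (hfield k f))) + L2_inner (hfield k f) (weight (hfield k f))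
       + L2_inner (hfield k f) (weight (\<lambda>p. hdual k p * vf_T f p))" for k
  proof -
    have m: "hfield k f \<in> heis_tests" "weight (?E (hfield k f)) \<in> heis_tests" "weight (hfield k f) \<in> heis_tests"
      "weight (\<lambda>p. hdual k p * vf_T f p) \<in> heis_tests"
      by (intro heis_tests_intros f)+
    show ?thesis
      unfolding hfield_euler[OF f] weight_add
      by (simp add: L2_inner_add_right[OF test_functions_add[OF m(2,3)] m(4,1)] L2_inner_add_right[OF m(2,3,1)])
  qed
  have euler_k: "Re (L2_inner (hfield k f) (weight (?E (hfield k f)))) = (2 - N) / 2 * Re (L2_inner (hfield k f) (weight (hfield k f)))" for k
    using Re_L2_inner_euler_weight_pow[OF heis_tests_hfield[OF f, of k], where m = 1] Re_L2_inner_commute[of "hfield k f" "weight (?E (hfield k f))"]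
    by (simp add: L2_inner_weight N)
  let ?A = "\<Sum>k\<in>UNIV. Re (L2_inner (hfield k f) (weight (hfield k f)))"
  have "Re (\<Sum>k\<in>UNIV. L2_inner (hfield k f) (weight (\<lambda>p. hdual k p * vf_T f p)))
     = Re (ZT_integral f) - 1/2 * (L2_norm (vf_T f))\<^sup>2"
    unfolding sum_L2_inner_hfield_hdual[OF f] by (simp add: L2_norm_squared_L2_inner)
  then have "Re (\<Sum>k\<in>UNIV. L2_inner (hfield k f) (weight (hfield k (?E f))))
     = (2 - N) / 2 * ?A + ?A + (Re (ZT_integral f) - 1/2 * (L2_norm (vf_T f))\<^sup>2)"
    by (simp add: term_k euler_k sum.distrib sum_distrib_left)
  moreover have "Re (L2_inner (sub_laplacian f) (weight (?E f)))
     = - Re (\<Sum>k\<in>UNIV. L2_inner (hfield k f) (weight (hfield k (?E f)))) + 2 * (L2_norm (weight (?E f)))\<^sup>2"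
    unfolding L2_inner_sub_laplacian_weight[OF f heis_tests_euler[OF f]] by (simp add: L2_norm_squared_L2_inner L2_inner_weight)
  ultimately show ?thesis
    unfolding hgrad_weighted_norm(1)[OF f] by (simp add: field_simps)
qed

text \<open>The right-hand side is the squared norm of \<open>L f + a (x . grad f) / |x|^2 + b f / |x|^2\<close>, where
  \<open>L\<close> is the sub-Laplacian and \<open>x\<close> the horizontal point, with the cross terms integrated by parts.\<close>

lemma factorization_inequality:
  fixes f :: "'n::finite heis \<Rightarrow> complex" and a b :: real
  assumes f: "f \<in> heis_tests" and N: "N = 2 * real CARD('n)"
  defines "A \<equiv> (L2_norm (\<lambda>p. hgrad f p /\<^sub>R norm (horiz p)))\<^sup>2"
    and "B \<equiv> (L2_norm (\<lambda>p. horiz_dot_hgrad f p /\<^sub>R (norm (horiz p))\<^sup>2))\<^sup>2"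
    and "C \<equiv> (L2_norm (\<lambda>p. f p /\<^sub>R (norm (horiz p))\<^sup>2))\<^sup>2"
  shows "0 \<le> (L2_norm (sub_laplacian f))\<^sup>2 + a\<^sup>2 * B + b\<^sup>2 * C
    + a * (4 * B + (N - 4) * A - 2 * Re (ZT_integral f) + (L2_norm (vf_T f))\<^sup>2)
    - 2 * b * (A + (N - 4) * C) - a * b * (N - 4) * C"
proof -
  let ?u = "sub_laplacian f" and ?v = "weight (horiz_dot_hgrad f)" and ?z = "weight f"
  have "2 * Re (L2_inner ?v ?z) = - (N - 4) * C"
    using Re_L2_inner_euler_weight_pow[OF f, of 2] by (simp add: C_def weight_scaleR L2_norm_squared_L2_inner L2_inner_weight weight_pow_2 N)
  then have vz: "2 * a * b * Re (L2_inner ?v ?z) = - a * b * (N - 4) * C"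
    by (metis (no_types, opaque_lifting) mult.assoc mult.left_commute mult_minus_left)
  have "0 \<le> Re (L2_inner ?u ?u) + a\<^sup>2 * Re (L2_inner ?v ?v) + b\<^sup>2 * Re (L2_inner ?z ?z)
    + 2 * a * Re (L2_inner ?u ?v) + 2 * b * Re (L2_inner ?u ?z) + 2 * a * b * Re (L2_inner ?v ?z)"
    by (rule Re_L2_inner_square_nonneg[where \<Omega> = "{p. horiz p \<noteq> 0}"]) (intro heis_tests_intros f)+
  then show ?thesis
    unfolding vz Re_L2_inner_sub_laplacian_weighted[OF f N] Re_L2_inner_sub_laplacian_euler[OF f N]
      A_def B_def C_def weight_scaleR L2_norm_squared_L2_inner[symmetric]
    by (simp add: field_simps)
qed

theorem theorem5p1:
  fixes f :: "'n::finite heis \<Rightarrow> complex" and \<alpha> \<beta> N :: real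
  assumes N: "N = 2 * real CARD('n)"
    and f: "f \<in> test_functions {p. horiz p \<noteq> 0}"
  shows
    "(L2_norm (sub_laplacian f))\<^sup>2
       \<ge> ((N - 4) * \<alpha> - 2 * \<beta>) * (L2_norm (\<lambda>p. hgrad f p /\<^sub>R norm (horiz p)))\<^sup>2
         - \<alpha> * (\<alpha> - 4) * (L2_norm (\<lambda>p. horiz_dot_hgrad f p /\<^sub>R (norm (horiz p))\<^sup>2))\<^sup>2
         + \<beta> * ((N - 4) * (\<alpha> - 2) - \<beta>) * (L2_norm (\<lambda>p. f p /\<^sub>R (norm (horiz p))\<^sup>2))\<^sup>2
         - 2 * \<alpha> * Re (ZT_integral f) + \<alpha> * (L2_norm (vf_T f))\<^sup>2
   \<and> (L2_norm (sub_laplacian f))\<^sup>2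
       \<ge> (N * \<alpha> - 2 * \<beta>) * (L2_norm (\<lambda>p. hgrad f p /\<^sub>R norm (horiz p)))\<^sup>2
         - \<alpha> * (\<alpha> + 4) * (L2_norm (\<lambda>p. horiz_dot_hgrad f p /\<^sub>R (norm (horiz p))\<^sup>2))\<^sup>2
         + (2 * (N - 4) * (\<alpha> * (N - 2) - \<beta>) - 2 * \<alpha>\<^sup>2 * (N - 2) + \<alpha> * \<beta> * N - \<beta>\<^sup>2)
             * (L2_norm (\<lambda>p. f p /\<^sub>R (norm (horiz p))\<^sup>2))\<^sup>2
         + 2 * \<alpha> * Re (ZT_integral f) - \<alpha> * (L2_norm (vf_T f))\<^sup>2
   \<and> (\<alpha> * (\<alpha> - 4) \<ge> 0 \<longrightarrow>
       (L2_norm (sub_laplacian f))\<^sup>2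
       \<ge> ((N - \<alpha>) * \<alpha> - 2 * \<beta>) * (L2_norm (\<lambda>p. hgrad f p /\<^sub>R norm (horiz p)))\<^sup>2
         + \<beta> * ((N - 4) * (\<alpha> - 2) - \<beta>) * (L2_norm (\<lambda>p. f p /\<^sub>R (norm (horiz p))\<^sup>2))\<^sup>2
         - 2 * \<alpha> * Re (ZT_integral f) + \<alpha> * (L2_norm (vf_T f))\<^sup>2)
   \<and> (\<alpha> * (\<alpha> + 4) \<ge> 0 \<longrightarrow>
       (L2_norm (sub_laplacian f))\<^sup>2
       \<ge> (- 2 * \<beta> + \<alpha> * (N - \<alpha>) - 4 * \<alpha>) * (L2_norm (\<lambda>p. hgrad f p /\<^sub>R norm (horiz p)))\<^sup>2
         + (2 * (N - 4) * (\<alpha> * (N - 2) - \<beta>) - 2 * \<alpha>\<^sup>2 * (N - 2) + \<alpha> * \<beta> * N - \<beta>\<^sup>2)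
             * (L2_norm (\<lambda>p. f p /\<^sub>R (norm (horiz p))\<^sup>2))\<^sup>2
         + 2 * \<alpha> * Re (ZT_integral f) - \<alpha> * (L2_norm (vf_T f))\<^sup>2)"
proof -
  define L where "L = (L2_norm (sub_laplacian f))\<^sup>2"
  define A where "A = (L2_norm (\<lambda>p. hgrad f p /\<^sub>R norm (horiz p)))\<^sup>2"
  define B where "B = (L2_norm (\<lambda>p. horiz_dot_hgrad f p /\<^sub>R (norm (horiz p))\<^sup>2))\<^sup>2"
  define C where "C = (L2_norm (\<lambda>p. f p /\<^sub>R (norm (horiz p))\<^sup>2))\<^sup>2"
  define Q where "Q = Re (ZT_integral f)"
  define \<tau> where "\<tau> = (L2_norm (vf_T f))\<^sup>2"
  note defs = L_def A_def B_def C_def Q_def \<tau>_def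
  have sq: "0 \<le> L + a\<^sup>2 * B + b\<^sup>2 * C + a * (4 * B + (N - 4) * A - 2 * Q + \<tau>)
    - 2 * b * (A + (N - 4) * C) - a * b * (N - 4) * C" for a b
    unfolding defs by (rule factorization_inequality[OF f N])
  have BA: "B \<le> A"
    unfolding A_def B_def by (rule euler_le_hgrad[OF f])
  have 1: "L \<ge> ((N - 4) * \<alpha> - 2 * \<beta>) * A - \<alpha> * (\<alpha> - 4) * B + \<beta> * ((N - 4) * (\<alpha> - 2) - \<beta>) * C
      - 2 * \<alpha> * Q + \<alpha> * \<tau>"
    using sq[of "-\<alpha>" "-\<beta>"] by (simp add: algebra_simps power2_eq_square)
  \<comment> \<open>These are the coefficients of the formal adjoint of the operator that gave the first inequality.\<close>
  have 2: "L \<ge> (N * \<alpha> - 2 * \<beta>) * A - \<alpha> * (\<alpha> + 4) * B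
      + (2 * (N - 4) * (\<alpha> * (N - 2) - \<beta>) - 2 * \<alpha>\<^sup>2 * (N - 2) + \<alpha> * \<beta> * N - \<beta>\<^sup>2) * C
      + 2 * \<alpha> * Q - \<alpha> * \<tau>"
    using sq[of \<alpha> "\<alpha> * (N - 2) - \<beta>"] by (simp add: algebra_simps power2_eq_square)
  have 3: "L \<ge> ((N - \<alpha>) * \<alpha> - 2 * \<beta>) * A + \<beta> * ((N - 4) * (\<alpha> - 2) - \<beta>) * C - 2 * \<alpha> * Q + \<alpha> * \<tau>"
    if "\<alpha> * (\<alpha> - 4) \<ge> 0"
    using 1 mult_left_mono[OF BA that] by (simp add: algebra_simps)
  have 4: "L \<ge> (- 2 * \<beta> + \<alpha> * (N - \<alpha>) - 4 * \<alpha>) * A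
      + (2 * (N - 4) * (\<alpha> * (N - 2) - \<beta>) - 2 * \<alpha>\<^sup>2 * (N - 2) + \<alpha> * \<beta> * N - \<beta>\<^sup>2) * C
      + 2 * \<alpha> * Q - \<alpha> * \<tau>"
    if "\<alpha> * (\<alpha> + 4) \<ge> 0"
    using 2 mult_left_mono[OF BA that] by (simp add: algebra_simps)
  from 1 2 3 4 show ?thesis
    unfolding defs by blast
qed

end
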